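(* Assume that $\mathrm{CU}$ can be evaluated in time $O(1)$. Then there is an algorithm with running time $O(T)$ that solves the separation problem for $\operatorname{epi}(\mathrm{LCU}^\Sigma)$: given a point $(v,c)\in[0,1]^T\times\mathbb{R}$, it either correctly reports that $(v,c)\in\operatorname{epi}(\mathrm{LCU}^\Sigma)$, or returns the coefficients $\alpha_t=\delta^t(l(t),r(t))$, $t\in[T]$, of the binary tree inequality $c\ge\sum_{t\in[T]}\alpha_t v^t$ of some rank-labeled binary tree on $[T]$, which is valid for $\operatorname{epi}(\mathrm{LCU}^\Sigma)$ and violated by the given point $(v,c)$.
   Context: Running time counts elementary operations, with arithmetic operations and comparisons of numbers having unit cost. Fix an integer $T\ge 1$, $[T]=\{1,\dots,T\}$ (periods), period lengths $L^1,\dots,L^T>0$, a pre-model offline time $\mathrm{PDT}\ge 0$, and a start-up cost function $\mathrm{CU}:[0,\infty)\to[0,\infty)$ that is (weakly) increasing, concave, and satisfies $\mathrm{CU}(0)=0$. For $t\in[T]$ and $l\in\{0,\dots,t-1\}$ let $\mathrm{OL}^t(l)=\sum_{j=1}^{l}L^{t-j}$ if $l<t-1$, and $\mathrm{OL}^t(l)=\sum_{j=1}^{l}L^{t-j}+\mathrm{PDT}$ if $l=t-1$; let $\mathrm{CU}^t(l)=\mathrm{CU}(\mathrm{OL}^t(l))$. For $v=(v^1,\dots,v^T)\in\{0,1\}^T$ let $\mathrm{ol}^t(v)=\max\{l\in\{0,\dots,t-1\}: v^{t-1}=\dots=v^{t-l}=0\}$, $\mathrm{DCU}^t(v)=\mathrm{CU}^t(\mathrm{ol}^t(v))$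 if $v^t=1$ and $\mathrm{DCU}^t(v)=0$ otherwise, and $\mathrm{DCU}^\Sigma(v)=\sum_{t=1}^T\mathrm{DCU}^t(v)$. Let $\operatorname{epi}(\mathrm{DCU}^\Sigma)=\{(v,c): v\in\{0,1\}^T,\ c\ge \mathrm{DCU}^\Sigma(v)\}$, and let $\mathrm{LCU}^\Sigma:[0,1]^T\to\mathbb{R}$ be the unique function whose epigraph $\operatorname{epi}(\mathrm{LCU}^\Sigma)=\{(v,c):v\in[0,1]^T,\ c\ge\mathrm{LCU}^\Sigma(v)\}$ equals $\operatorname{conv}(\operatorname{epi}(\mathrm{DCU}^\Sigma))$. For $t\in[T]$ define $\delta^t:\{0,\dots,t-1\}\times\{0,\dots,T-t\}\to\mathbb{R}$ by $\delta^t(l,r)=\mathrm{CU}^t(l)+\mathrm{CU}^{t+r+1}(r)-\mathrm{CU}^{t+r+1}(l+r+1)$ if $t+r<T$, and $\delta^t(l,r)=\mathrm{CU}^t(l)$ if $t+r=T$. A binary tree is a rooted tree in which every node has at most one left child and at most one right child. It is a rank-labeled binary tree on $[T]$ if its node set is $[T]$ and the in-order (left-to-right) position of each node $t$ is $t$; i.e. all nodes in the left subtree of $t$ are smaller than $t$ and all nodes in the right subtree of $t$ are larger than $t$. $l(t)$ and $r(t)$ denote the numbers of nodes in the left and right subtree of $t$ (0 if empty). *)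

theory Defs
  imports
    "HOL-Analysis.Analysis"
    "HOL-Analysis.Finite_Function_Topology"
    "HOL-Library.Tree"
    "HOL-Library.Landau_Symbols"
begin

section \<open>Start-up costs\<close>

text \<open>Period lengths are a function \<open>L\<close> on the naturals of which only the values
  on \<open>{1..T}\<close> matter; values of the start-up cost function \<open>CU\<close> at negative arguments
  are irrelevant.\<close>

definition uc_data :: "nat \<Rightarrow> (nat \<Rightarrow> real) \<Rightarrow> real \<Rightarrow> (real \<Rightarrow> real) \<Rightarrow> bool" where
  "uc_data T L PDT CU \<longleftrightarrow>
     T \<ge> 1 \<and> (\<forall>t\<in>{1..T}. L t > 0) \<and> PDT \<ge> 0 \<and>
     CU \<in> {0..} \<rightarrow> {0..} \<and> mono_on {0..} CU \<and> concave_on {0..} CU \<and> CU 0 = 0"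

definition OL :: "(nat \<Rightarrow> real) \<Rightarrow> real \<Rightarrow> nat \<Rightarrow> nat \<Rightarrow> real" where
  "OL L PDT t l = (\<Sum>j=1..l. L (t - j)) + (if l = t - 1 then PDT else 0)"

definition CUt :: "(nat \<Rightarrow> real) \<Rightarrow> real \<Rightarrow> (real \<Rightarrow> real) \<Rightarrow> nat \<Rightarrow> nat \<Rightarrow> real" where
  "CUt L PDT CU t l = CU (OL L PDT t l)"

text \<open>\<open>\<real>\<^sup>T\<close> is represented by the finitely supported functions on the naturals whose support
  is contained in \<open>{1..T}\<close>. They form a subspace of a single real vector space, so that
  \<open>T\<close> may vary.\<close>

definition binary_vectors :: "nat \<Rightarrow> (nat \<Rightarrow>\<^sub>0 real) set" where
  "binary_vectors T =
     {v. Poly_Mapping.keys v \<subseteq> {1..T} \<and> (\<forall>t\<in>{1..T}. Poly_Mapping.lookup v t \<in> {0, 1})}"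

definition cube01 :: "nat \<Rightarrow> (nat \<Rightarrow>\<^sub>0 real) set" where
  "cube01 T =
     {v. Poly_Mapping.keys v \<subseteq> {1..T} \<and> (\<forall>t\<in>{1..T}. Poly_Mapping.lookup v t \<in> {0..1})}"

definition ol :: "nat \<Rightarrow> (nat \<Rightarrow>\<^sub>0 real) \<Rightarrow> nat" where
  "ol t v = Max {l \<in> {0..t - 1}. \<forall>j\<in>{1..l}. Poly_Mapping.lookup v (t - j) = 0}"

definition DCUt ::
  "(nat \<Rightarrow> real) \<Rightarrow> real \<Rightarrow> (real \<Rightarrow> real) \<Rightarrow> nat \<Rightarrow> (nat \<Rightarrow>\<^sub>0 real) \<Rightarrow> real" where
  "DCUt L PDT CU t v =
     (if Poly_Mapping.lookup v t = 1 then CUt L PDT CU t (ol t v) else 0)"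

definition DCU ::
  "nat \<Rightarrow> (nat \<Rightarrow> real) \<Rightarrow> real \<Rightarrow> (real \<Rightarrow> real) \<Rightarrow> (nat \<Rightarrow>\<^sub>0 real) \<Rightarrow> real" where
  "DCU T L PDT CU v = (\<Sum>t=1..T. DCUt L PDT CU t v)"

text \<open>Restricting to \<open>extensional\<close> functions makes the function on the cube
  unique as a total function.\<close>

definition LCU ::
  "nat \<Rightarrow> (nat \<Rightarrow> real) \<Rightarrow> real \<Rightarrow> (real \<Rightarrow> real) \<Rightarrow> (nat \<Rightarrow>\<^sub>0 real) \<Rightarrow> real" where
  "LCU T L PDT CU =
     (THE f. f \<in> extensional (cube01 T) \<and>
        epigraph (cube01 T) f = convex hull (epigraph (binary_vectors T) (DCU T L PDT CU)))"

definition delta ::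
  "nat \<Rightarrow> (nat \<Rightarrow> real) \<Rightarrow> real \<Rightarrow> (real \<Rightarrow> real) \<Rightarrow> nat \<Rightarrow> nat \<Rightarrow> nat \<Rightarrow> real" where
  "delta T L PDT CU t l r =
     (if t + r < T
      then CUt L PDT CU t l + CUt L PDT CU (t + r + 1) r - CUt L PDT CU (t + r + 1) (l + r + 1)
      else CUt L PDT CU t l)"

definition rank_labeled :: "nat \<Rightarrow> nat tree \<Rightarrow> bool" where
  "rank_labeled T B \<longleftrightarrow> inorder B = [1..<Suc T]"

text \<open>In a rank-labeled tree every \<open>t\<close> is the root of exactly one subtree \<open>\<langle>l, t, r\<rangle>\<close>.\<close>

definition tree_coeffs ::
  "nat \<Rightarrow> (nat \<Rightarrow> real) \<Rightarrow> real \<Rightarrow> (real \<Rightarrow> real) \<Rightarrow> nat tree \<Rightarrow> (nat \<Rightarrow> real) \<Rightarrow> bool" where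
  "tree_coeffs T L PDT CU B \<alpha> \<longleftrightarrow>
     (\<forall>l t r. \<langle>l, t, r\<rangle> \<in> subtrees B \<longrightarrow> \<alpha> t = delta T L PDT CU t (size l) (size r))"


section \<open>Algorithms and running time\<close>

text \<open>A real RAM as a structured language. Memory consists of named arrays of natural numbers
  (for indices) and of real numbers; a scalar is the entry of an array at index 0. There is no
  conversion between the two kinds of numbers, and indices are only added and subtracted
  (truncated at 0). The function \<open>CU\<close> is available only through \<open>REvalCU\<close>.
  Division by zero yields 0.\<close>

record mem =
  nats :: "string \<Rightarrow> nat \<Rightarrow> nat"
  reals :: "string \<Rightarrow> nat \<Rightarrow> real"

datatype nexp =
    NNum nat
  | NRead string nexp
  | NAdd nexp nexp
  | NSub nexp nexp

datatype rexp =
    RNum int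
  | RRead string nexp
  | RAdd rexp rexp
  | RSub rexp rexp
  | RMul rexp rexp
  | RDiv rexp rexp
  | REvalCU rexp

datatype bexp =
    NLess nexp nexp
  | RLess rexp rexp
  | BNot bexp
  | BAnd bexp bexp

datatype com =
    Skip
  | NWrite string nexp nexp
  | RWrite string nexp rexp
  | Seq com com
  | If bexp com com
  | While bexp com

primrec nval :: "mem \<Rightarrow> nexp \<Rightarrow> nat" where
  "nval s (NNum k) = k"
| "nval s (NRead x i) = nats s x (nval s i)"
| "nval s (NAdd a b) = nval s a + nval s b"
| "nval s (NSub a b) = nval s a - nval s b"

primrec rval :: "(real \<Rightarrow> real) \<Rightarrow> mem \<Rightarrow> rexp \<Rightarrow> real" where
  "rval CU s (RNum k) = of_int k"
| "rval CU s (RRead x i) = reals s x (nval s i)"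
| "rval CU s (RAdd a b) = rval CU s a + rval CU s b"
| "rval CU s (RSub a b) = rval CU s a - rval CU s b"
| "rval CU s (RMul a b) = rval CU s a * rval CU s b"
| "rval CU s (RDiv a b) = rval CU s a / rval CU s b"
| "rval CU s (REvalCU a) = CU (rval CU s a)"

primrec bval :: "(real \<Rightarrow> real) \<Rightarrow> mem \<Rightarrow> bexp \<Rightarrow> bool" where
  "bval CU s (NLess a b) = (nval s a < nval s b)"
| "bval CU s (RLess a b) = (rval CU s a < rval CU s b)"
| "bval CU s (BNot p) = (\<not> bval CU s p)"
| "bval CU s (BAnd p q) = (bval CU s p \<and> bval CU s q)"

text \<open>Every elementary operation takes one step, except that an evaluation of \<open>CU\<close>
  at \<open>x\<close> takes \<open>\<tau> x\<close> additional steps.\<close>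

primrec ncost :: "nexp \<Rightarrow> nat" where
  "ncost (NNum k) = 1"
| "ncost (NRead x i) = ncost i + 1"
| "ncost (NAdd a b) = ncost a + ncost b + 1"
| "ncost (NSub a b) = ncost a + ncost b + 1"

primrec rcost :: "(real \<Rightarrow> real) \<Rightarrow> (real \<Rightarrow> nat) \<Rightarrow> mem \<Rightarrow> rexp \<Rightarrow> nat" where
  "rcost CU \<tau> s (RNum k) = 1"
| "rcost CU \<tau> s (RRead x i) = ncost i + 1"
| "rcost CU \<tau> s (RAdd a b) = rcost CU \<tau> s a + rcost CU \<tau> s b + 1"
| "rcost CU \<tau> s (RSub a b) = rcost CU \<tau> s a + rcost CU \<tau> s b + 1"
| "rcost CU \<tau> s (RMul a b) = rcost CU \<tau> s a + rcost CU \<tau> s b + 1"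
| "rcost CU \<tau> s (RDiv a b) = rcost CU \<tau> s a + rcost CU \<tau> s b + 1"
| "rcost CU \<tau> s (REvalCU a) = rcost CU \<tau> s a + \<tau> (rval CU s a) + 1"

primrec bcost :: "(real \<Rightarrow> real) \<Rightarrow> (real \<Rightarrow> nat) \<Rightarrow> mem \<Rightarrow> bexp \<Rightarrow> nat" where
  "bcost CU \<tau> s (NLess a b) = ncost a + ncost b + 1"
| "bcost CU \<tau> s (RLess a b) = rcost CU \<tau> s a + rcost CU \<tau> s b + 1"
| "bcost CU \<tau> s (BNot p) = bcost CU \<tau> s p + 1"
| "bcost CU \<tau> s (BAnd p q) = bcost CU \<tau> s p + bcost CU \<tau> s q + 1"

definition nwrite :: "string \<Rightarrow> nat \<Rightarrow> nat \<Rightarrow> mem \<Rightarrow> mem" where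
  "nwrite x i k s = s\<lparr>nats := (nats s)(x := (nats s x)(i := k))\<rparr>"

definition rwrite :: "string \<Rightarrow> nat \<Rightarrow> real \<Rightarrow> mem \<Rightarrow> mem" where
  "rwrite x i a s = s\<lparr>reals := (reals s)(x := (reals s x)(i := a))\<rparr>"

text \<open>\<open>exec CU \<tau> p s n s'\<close>: program \<open>p\<close> started in memory \<open>s\<close> halts after \<open>n\<close> steps
  in memory \<open>s'\<close>.\<close>

inductive exec ::
  "(real \<Rightarrow> real) \<Rightarrow> (real \<Rightarrow> nat) \<Rightarrow> com \<Rightarrow> mem \<Rightarrow> nat \<Rightarrow> mem \<Rightarrow> bool"
  for CU :: "real \<Rightarrow> real" and \<tau> :: "real \<Rightarrow> nat" where
  Skip: "exec CU \<tau> Skip s 1 s"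
| NWrite: "exec CU \<tau> (NWrite x i e) s (ncost i + ncost e + 1) (nwrite x (nval s i) (nval s e) s)"
| RWrite: "exec CU \<tau> (RWrite x i e) s (ncost i + rcost CU \<tau> s e + 1)
             (rwrite x (nval s i) (rval CU s e) s)"
| Seq: "exec CU \<tau> p s m s' \<Longrightarrow> exec CU \<tau> q s' n s'' \<Longrightarrow> exec CU \<tau> (Seq p q) s (m + n) s''"
| IfTrue: "bval CU s b \<Longrightarrow> exec CU \<tau> p s n s' \<Longrightarrow>
             exec CU \<tau> (If b p q) s (bcost CU \<tau> s b + n + 1) s'"
| IfFalse: "\<not> bval CU s b \<Longrightarrow> exec CU \<tau> q s n s' \<Longrightarrow>
             exec CU \<tau> (If b p q) s (bcost CU \<tau> s b + n + 1) s'"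
| WhileFalse: "\<not> bval CU s b \<Longrightarrow> exec CU \<tau> (While b p) s (bcost CU \<tau> s b + 1) s"
| WhileTrue: "bval CU s b \<Longrightarrow> exec CU \<tau> p s m s' \<Longrightarrow> exec CU \<tau> (While b p) s' n s'' \<Longrightarrow>
             exec CU \<tau> (While b p) s (bcost CU \<tau> s b + m + n + 1) s''"

inductive_cases SkipE: "exec CU \<tau> Skip s n s'"
inductive_cases NWriteE: "exec CU \<tau> (NWrite x i e) s n s'"
inductive_cases RWriteE: "exec CU \<tau> (RWrite x i e) s n s'"
inductive_cases SeqE: "exec CU \<tau> (Seq p q) s n s'"
inductive_cases IfE: "exec CU \<tau> (If b p q) s n s'"
inductive_cases WhileE: "exec CU \<tau> (While b p) s n s'"

lemma exec_deterministic:
  "exec CU \<tau> p s n s' \<Longrightarrow> exec CU \<tau> p s n' s'' \<Longrightarrow> n' = n \<and> s'' = s'"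
proof (induction arbitrary: n' s'' rule: exec.induct)
  case (Skip s)
  from Skip show ?case by (rule SkipE) simp
next
  case (NWrite x i e s)
  from NWrite show ?case by (rule NWriteE) simp
next
  case (RWrite x i e s)
  from RWrite show ?case by (rule RWriteE) simp
next
  case (Seq p s m s1 q n s2)
  from Seq.prems show ?case
    by (rule SeqE) (metis Seq.IH)
next
  case (IfTrue s b p n s1 q)
  from IfTrue.prems show ?case
    by (rule IfE) (auto simp: IfTrue.hyps(1) dest: IfTrue.IH)
next
  case (IfFalse s b q n s1 p)
  from IfFalse.prems show ?case
    by (rule IfE) (auto simp: IfFalse.hyps(1) dest: IfFalse.IH)
next
  case (WhileFalse s b p)
  from WhileFalse.prems show ?case
    by (rule WhileE) (auto simp: WhileFalse.hyps)
next
  case (WhileTrue s b p m s1 n s2)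
  from WhileTrue.prems show ?case
    by (rule WhileE) (auto simp: WhileTrue.hyps(1) dest: WhileTrue.IH)
qed

text \<open>Memory outside the input cells is arbitrary, i.e. uninitialised.\<close>

definition is_input ::
  "mem \<Rightarrow> nat \<Rightarrow> (nat \<Rightarrow> real) \<Rightarrow> real \<Rightarrow> (nat \<Rightarrow>\<^sub>0 real) \<Rightarrow> real \<Rightarrow> bool" where
  "is_input s T L PDT v c \<longleftrightarrow>
     nats s ''T'' 0 = T \<and> reals s ''PDT'' 0 = PDT \<and> reals s ''c'' 0 = c \<and>
     (\<forall>t\<in>{1..T}. reals s ''L'' t = L t \<and> reals s ''v'' t = Poly_Mapping.lookup v t)"

definition reports_membership :: "mem \<Rightarrow> bool" where
  "reports_membership s \<longleftrightarrow> nats s ''member'' 0 = 1"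

definition returned_coeffs :: "mem \<Rightarrow> nat \<Rightarrow> real" where
  "returned_coeffs s = reals s ''alpha''"

definition correct_separation_output ::
  "nat \<Rightarrow> (nat \<Rightarrow> real) \<Rightarrow> real \<Rightarrow> (real \<Rightarrow> real) \<Rightarrow> (nat \<Rightarrow>\<^sub>0 real) \<Rightarrow> real \<Rightarrow> mem \<Rightarrow> bool" where
  "correct_separation_output T L PDT CU v c s \<longleftrightarrow>
     (if reports_membership s
      then (v, c) \<in> epigraph (cube01 T) (LCU T L PDT CU)
      else
        (\<exists>B. rank_labeled T B \<and> tree_coeffs T L PDT CU B (returned_coeffs s)) \<and>
        (\<forall>(w, d) \<in> epigraph (cube01 T) (LCU T L PDT CU).
           d \<ge> (\<Sum>t=1..T. returned_coeffs s t * Poly_Mapping.lookup w t)) \<and>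
        c < (\<Sum>t=1..T. returned_coeffs s t * Poly_Mapping.lookup v t))"

end

theory Submission
  imports Defs
begin

text \<open>
  As a function of the set of operational periods, the total start-up cost is submodular: turning
  on period \<open>t\<close> between the operational neighbours \<open>a < t < b\<close> costs
  \<open>E a t + E t b - E a b\<close>, where \<open>E\<close> is the start-up cost of an idle gap, and concavity and
  monotonicity of \<open>CU\<close> make \<open>E\<close> a Monge array, so that this cost decreases when \<open>a\<close> and \<open>b\<close>
  move closer. Hence the convex envelope is the Lovasz extension, and each tree inequality
  is valid. The greedy order that attains the maximum at \<open>v\<close> is encoded by the Cartesian
  tree of \<open>v\<close>, in which every node carries a maximal entry of its subtree. The classical stack
  algorithm builds that tree in linear time; when a node is popped, the two ends of its interval,
  and hence its coefficient, are known.
\<close>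

section \<open>Binary trees and path costs\<close>

primrec path_cost :: "(nat \<Rightarrow> nat \<Rightarrow> real) \<Rightarrow> nat \<Rightarrow> nat list \<Rightarrow> real" where
  "path_cost E a [] = 0"
| "path_cost E a (x # xs) = E a x + path_cost E x xs"

lemma path_cost_append:
  "path_cost E a (xs @ ys) = path_cost E a xs + path_cost E (last (a # xs)) ys"
  by (induction xs arbitrary: a) auto

text \<open>The arguments \<open>a\<close> and \<open>b\<close> are the excluded ends of the label
  interval of the subtree. The coefficient is the extra path cost of inserting \<open>t\<close> when
  \<open>a\<close> and \<open>b\<close> are its nearest chosen neighbours; for gap costs it becomes
  \<open>delta\<close>.\<close>

primrec tree_sum :: "(nat \<Rightarrow> nat \<Rightarrow> real) \<Rightarrow> nat \<Rightarrow> nat tree \<Rightarrow> nat \<Rightarrow> (nat \<Rightarrow> real) \<Rightarrow> real" where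
  "tree_sum E a \<langle>\<rangle> b w = 0"
| "tree_sum E a \<langle>l, t, r\<rangle> b w =
     (E a t + E t b - E a b) * w t + tree_sum E a l t w + tree_sum E t r b w"

lemma tree_sum_combine:
  "tree_sum E a B b (\<lambda>t. x * w t + y * w' t) = x * tree_sum E a B b w + y * tree_sum E a B b w'"
  by (induction B arbitrary: a b) (auto simp: algebra_simps)

text \<open>The strict inequality \<open>a' < b'\<close> keeps all four index pairs increasing, the
  only pairs on which gap costs have a meaning.\<close>

definition monge :: "nat \<Rightarrow> (nat \<Rightarrow> nat \<Rightarrow> real) \<Rightarrow> bool" where
  "monge N E \<longleftrightarrow> (\<forall>a a' b' b. a \<le> a' \<and> a' < b' \<and> b' \<le> b \<and> b \<le> N \<longrightarrow>
     E a' b' + E a b \<le> E a b' + E a' b)"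

text \<open>This is submodularity of path costs. One Monge inequality moves the left end from
  \<open>a\<close> to \<open>a'\<close>, a second one moves the right end from \<open>b\<close> to
  \<open>b'\<close>.\<close>

lemma monge_insertion_cost_mono:
  assumes "monge N E" "a \<le> a'" "a' < t" "t < b'" "b' \<le> b" "b \<le> N"
  shows "E a' t + E t b' - E a' b' \<le> E a t + E t b - E a b"
proof -
  have "E a' t + E a b' \<le> E a t + E a' b'" "E t b' + E a b \<le> E a b' + E t b"
    using assms unfolding monge_def by auto
  then show ?thesis by linarith
qed

text \<open>If the root is chosen, the path splits at the root and the two induction hypotheses add
  up. Otherwise they bound the path with a detour through the root, and by the Monge property the
  detour costs at most the root coefficient.\<close>

lemma tree_sum_le_path_cost:
  assumes "monge N E" "sorted_wrt (<) (a # inorder B @ [b])" "b \<le> N"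
    "\<forall>t\<in>set_tree B. w t \<in> {0, 1}"
  shows "tree_sum E a B b w + E a b \<le> path_cost E a (filter (\<lambda>t. w t = 1) (inorder B) @ [b])"
  using assms(2-)
proof (induction B arbitrary: a b)
  case Leaf
  then show ?case by simp
next
  case (Node l t r)
  define xs ys where "xs = filter (\<lambda>t. w t = 1) (inorder l)"
    and "ys = filter (\<lambda>t. w t = 1) (inorder r)"
  have l: "tree_sum E a l t w + E a t \<le> path_cost E a (xs @ [t])"
    unfolding xs_def using Node.prems by (intro Node.IH(1)) (auto simp: sorted_wrt_append)
  have r: "tree_sum E t r b w + E t b \<le> path_cost E t (ys @ [b])"
    unfolding ys_def using Node.prems by (intro Node.IH(2)) (auto simp: sorted_wrt_append)
  show ?case
  proof (cases "w t = 1")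
    case True
    then show ?thesis using l r
      by (simp add: xs_def[symmetric] ys_def[symmetric] path_cost_append)
  next
    case False
    then have 0: "w t = 0" using Node.prems by auto
    \<comment> \<open>The nodes \<open>p\<close> and \<open>q\<close> are the neighbours of
      \<open>t\<close> on the actual path: the nearest chosen labels, or the ends \<open>a\<close>
      and \<open>b\<close>.\<close>
    obtain q zs where q: "ys @ [b] = q # zs" by (cases ys) auto
    define p where "p = last (a # xs)"
    have "q \<in> set (ys @ [b])" by (simp add: q)
    then have "t < q" "q \<le> b"
      using Node.prems(1) by (auto simp: ys_def sorted_wrt_append)
    moreover have "p \<in> set (a # xs)" unfolding p_def by (rule last_in_set) simp
    then have "a \<le> p" "p < t"
      using Node.prems(1) by (auto simp: xs_def sorted_wrt_append intro: less_imp_le)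
    ultimately have "E p t + E t q - E p q \<le> E a t + E t b - E a b"
      using Node.prems(2) by (intro monge_insertion_cost_mono[OF assms(1)]) auto
    moreover have "path_cost E a (xs @ ys @ [b]) = path_cost E a xs + E p q + path_cost E q zs"
      unfolding q by (simp add: path_cost_append p_def)
    moreover have "path_cost E a (xs @ [t]) = path_cost E a xs + E p t"
      by (simp add: path_cost_append p_def)
    moreover have "path_cost E t (ys @ [b]) = E t q + path_cost E q zs"
      unfolding q by simp
    ultimately show ?thesis using l r 0
      by (simp add: xs_def[symmetric] ys_def[symmetric])
  qed
qed

text \<open>The leaf clause forces the in-order labels to be exactly the integers strictly between
  \<open>a\<close> and \<open>b\<close>, so that heap order and search order are captured
  together.\<close>

primrec cartesian :: "(nat \<Rightarrow> real) \<Rightarrow> nat \<Rightarrow> nat tree \<Rightarrow> nat \<Rightarrow> bool" where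
  "cartesian v a \<langle>\<rangle> b \<longleftrightarrow> b = Suc a"
| "cartesian v a \<langle>l, x, r\<rangle> b \<longleftrightarrow>
     (\<forall>y\<in>set_tree l \<union> set_tree r. v y \<le> v x) \<and> cartesian v a l x \<and> cartesian v x r b"

lemma cartesian_inorder: "cartesian v a C b \<Longrightarrow> a < b \<and> inorder C = [Suc a..<b]"
proof (induction C arbitrary: a b)
  case (Node l x r)
  then have "a < x \<and> inorder l = [Suc a..<x]" "x < b \<and> inorder r = [Suc x..<b]" by auto
  moreover from this have "[Suc a..<b] = [Suc a..<x] @ x # [Suc x..<b]"
    by (metis Suc_leI le_add_diff_inverse less_imp_le_nat upt_add_eq_append upt_conv_Cons)
  ultimately show ?case by simp
qed simp

lemma cartesian_set_tree: "cartesian v a C b \<Longrightarrow> set_tree C = {a<..<b}"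
  by (drule cartesian_inorder) (metis atLeastSucLessThan_greaterThanLessThan set_inorder set_upt)

lemma cartesian_size: "cartesian v a C b \<Longrightarrow> size C = b - Suc a"
  by (metis cartesian_inorder length_inorder length_upt)

text \<open>A maximal entry of the interval serves as root. Existence matters for identifying
  \<open>LCU\<close>; the algorithm builds its own tree.\<close>

lemma cartesian_exists: "a < b \<Longrightarrow> \<exists>C. cartesian v a C b"
proof (induction "b - a" arbitrary: a b rule: less_induct)
  case less
  show ?case
  proof (cases "b = Suc a")
    case True
    then show ?thesis by (intro exI[of _ "\<langle>\<rangle>"]) simp
  next
    case False
    define A where "A = {a<..<b}"
    have "Suc a \<in> A" using False less.prems by (auto simp: A_def)
    then have "finite A" "A \<noteq> {}" by (auto simp: A_def)
    then obtain x where x: "x \<in> A" "v x = Max (v ` A)"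
      by (metis (no_types, lifting) Max_in finite_imageI image_is_empty image_iff)
    have max: "\<forall>y\<in>A. v y \<le> v x" using \<open>finite A\<close> x(2) by simp
    obtain l where l: "cartesian v a l x" using less.hyps[of x a] x(1) by (fastforce simp: A_def)
    obtain r where r: "cartesian v x r b" using less.hyps[of b x] x(1) by (fastforce simp: A_def)
    have "cartesian v a \<langle>l, x, r\<rangle> b"
      using l r max x(1) by (auto simp: cartesian_set_tree A_def)
    then show ?thesis ..
  qed
qed

text \<open>Only the weak order of the entries matters. Hence all pieces of the convex decomposition
  of a point can share its tree.\<close>

lemma cartesian_mono:
  assumes "cartesian v a C b" "\<And>x y. v y \<le> v x \<Longrightarrow> w y \<le> w x"
  shows "cartesian w a C b"
  using assms(1) by (induction C arbitrary: a b) (auto intro: assms(2))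

text \<open>With the heap order, an element is inserted only after all its ancestors, so the
  insertion costs add up exactly.\<close>

lemma tree_sum_eq_path_cost:
  assumes "cartesian w a B b" "\<forall>t\<in>set_tree B. w t \<in> {0, 1}"
  shows "tree_sum E a B b w + E a b = path_cost E a (filter (\<lambda>t. w t = 1) (inorder B) @ [b])"
  using assms
proof (induction B arbitrary: a b)
  case Leaf
  then show ?case by simp
next
  case (Node l t r)
  have l: "tree_sum E a l t w + E a t = path_cost E a (filter (\<lambda>t. w t = 1) (inorder l) @ [t])"
    using Node.prems by (intro Node.IH(1)) auto
  have r: "tree_sum E t r b w + E t b = path_cost E t (filter (\<lambda>t. w t = 1) (inorder r) @ [b])"
    using Node.prems by (intro Node.IH(2)) auto
  show ?case
  proof (cases "w t = 1")
    case True
    then show ?thesis using l r by (simp add: path_cost_append)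
  next
    case False
    then have "w t = 0" using Node.prems by auto
    \<comment> \<open>By heap order, an unchosen root has only unchosen descendants, so both partial
      paths are single edges and both partial sums are zero.\<close>
    moreover have "filter (\<lambda>t. w t = 1) (inorder l) = []" "filter (\<lambda>t. w t = 1) (inorder r) = []"
      using Node.prems(1) \<open>w t = 0\<close> by (force simp: filter_empty_conv)+
    ultimately show ?thesis using l r by simp
  qed
qed

text \<open>Separates the coefficient array from the tree: the program stores only the former, while
  the tree exists only in the proof.\<close>

primrec carries ::
  "(nat \<Rightarrow> nat \<Rightarrow> real) \<Rightarrow> (nat \<Rightarrow> real) \<Rightarrow> nat \<Rightarrow> nat tree \<Rightarrow> nat \<Rightarrow> bool" where
  "carries E \<alpha> a \<langle>\<rangle> b \<longleftrightarrow> True"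
| "carries E \<alpha> a \<langle>l, x, r\<rangle> b \<longleftrightarrow>
     \<alpha> x = E a x + E x b - E a b \<and> carries E \<alpha> a l x \<and> carries E \<alpha> x r b"

lemma carries_cong:
  assumes "carries E \<alpha> a C b" "\<And>x. x \<in> set_tree C \<Longrightarrow> \<alpha>' x = \<alpha> x"
  shows "carries E \<alpha>' a C b"
  using assms by (induction C arbitrary: a b) auto

lemma tree_sum_carries:
  assumes "cartesian v a C b" "carries E \<alpha> a C b"
  shows "tree_sum E a C b w = (\<Sum>t\<in>{a<..<b}. \<alpha> t * w t)"
  using assms
proof (induction C arbitrary: a b)
  case Leaf
  then show ?case by (simp add: atLeastSucLessThan_greaterThanLessThan[symmetric])
next
  case (Node l x r)
  then have "a < x" "x < b" using cartesian_inorder by auto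
  then have "{a<..<b} = insert x ({a<..<x} \<union> {x<..<b})" by auto
  then have "(\<Sum>t\<in>{a<..<b}. \<alpha> t * w t) =
      \<alpha> x * w x + ((\<Sum>t\<in>{a<..<x}. \<alpha> t * w t) + (\<Sum>t\<in>{x<..<b}. \<alpha> t * w t))"
    by (simp add: sum.union_disjoint[symmetric])
  then show ?case using Node by simp
qed

section \<open>The convex envelope of the start-up costs\<close>

text \<open>\<open>gap_cost a b\<close> is the start-up cost of period \<open>b\<close> if \<open>a\<close> is the last operational period
  before it, where \<open>a = 0\<close> stands for the time before the model and \<open>b = T + 1\<close> for its end.\<close>

definition gap_cost ::
  "nat \<Rightarrow> (nat \<Rightarrow> real) \<Rightarrow> real \<Rightarrow> (real \<Rightarrow> real) \<Rightarrow> nat \<Rightarrow> nat \<Rightarrow> real" where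
  "gap_cost T L PDT CU a b = (if b \<le> T then CUt L PDT CU b (b - Suc a) else 0)"

section \<open>Monge property of the gap costs\<close>

definition period_start :: "(nat \<Rightarrow> real) \<Rightarrow> real \<Rightarrow> nat \<Rightarrow> real" where
  "period_start L PDT t = PDT + (\<Sum>j\<in>{1..<t}. L j)"

text \<open>The clock starts with the pre-model offline time, so the fictitious period 0 ends at 0
  and period 1 starts at \<open>PDT\<close>. This absorbs the special case of \<open>OL\<close> and
  makes every offline time a difference of two table entries.\<close>

definition period_end :: "(nat \<Rightarrow> real) \<Rightarrow> real \<Rightarrow> nat \<Rightarrow> real" where
  "period_end L PDT t = (if t = 0 then 0 else PDT + (\<Sum>j\<in>{1..t}. L j))"

lemma OL_eq_start_minus_end:
  assumes "a < b"
  shows "OL L PDT b (b - Suc a) = period_start L PDT b - period_end L PDT a"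
proof -
  have "(\<Sum>j=1..b - Suc a. L (b - j)) = (\<Sum>j\<in>{Suc a..<b}. L j)"
    by (rule sum.reindex_bij_witness[of _ "\<lambda>j. b - j" "\<lambda>j. b - j"]) (use assms in auto)
  moreover have "(\<Sum>j\<in>{1..<b}. L j) = (\<Sum>j\<in>{1..a}. L j) + (\<Sum>j\<in>{Suc a..<b}. L j)"
    using assms sum.atLeastLessThan_concat[of 1 "Suc a" b L]
    by (simp add: atLeastLessThanSuc_atLeastAtMost)
  ultimately show ?thesis using assms
    by (auto simp: OL_def period_start_def period_end_def)
qed

lemma gap_cost_eq:
  "a < b \<Longrightarrow> b \<le> T \<Longrightarrow>
    gap_cost T L PDT CU a b = CU (period_start L PDT b - period_end L PDT a)"
  by (simp add: gap_cost_def CUt_def OL_eq_start_minus_end)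

lemma period_start_mono:
  assumes "uc_data T L PDT CU" "a \<le> b" "b \<le> T"
  shows "period_start L PDT a \<le> period_start L PDT b"
  unfolding period_start_def using assms
  by (intro add_left_mono sum_mono2) (auto simp: uc_data_def intro: less_imp_le)

lemma period_end_mono:
  assumes "uc_data T L PDT CU" "a \<le> b" "b \<le> T"
  shows "period_end L PDT a \<le> period_end L PDT b"
proof (cases "a = 0")
  case True
  have "0 \<le> (\<Sum>j\<in>{1..b}. L j)"
    using assms by (intro sum_nonneg) (auto simp: uc_data_def intro: less_imp_le)
  with True show ?thesis using assms by (auto simp: period_end_def uc_data_def)
next
  case False
  have "(\<Sum>j\<in>{1..a}. L j) \<le> (\<Sum>j\<in>{1..b}. L j)"
    using assms by (intro sum_mono2) (auto simp: uc_data_def intro: less_imp_le)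
  then show ?thesis using assms False by (auto simp: period_end_def)
qed

lemma period_end_le_start:
  assumes "uc_data T L PDT CU" "a < b" "b \<le> T"
  shows "period_end L PDT a \<le> period_start L PDT b"
proof (cases "a = 0")
  case True
  then show ?thesis using assms
    by (auto simp: period_start_def period_end_def uc_data_def
        intro!: add_nonneg_nonneg sum_nonneg intro: less_imp_le)
next
  case False
  have "(\<Sum>j\<in>{1..a}. L j) \<le> (\<Sum>j\<in>{1..<b}. L j)"
    using assms by (intro sum_mono2) (auto simp: uc_data_def intro: less_imp_le)
  with False show ?thesis by (simp add: period_start_def period_end_def)
qed

text \<open>The points \<open>x + d\<close> and \<open>y\<close> lie between \<open>x\<close> and
  \<open>y + d\<close> with mirrored weights; adding the two concavity inequalities gives the
  claim.\<close>

lemma concave_increment_antimono: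
  fixes f :: "real \<Rightarrow> real"
  assumes "concave_on {0..} f" "0 \<le> x" "x \<le> y" "0 \<le> d"
  shows "f (y + d) + f x \<le> f (x + d) + f y"
proof (cases "y - x + d = 0")
  case True
  with assms have "x = y" "d = 0" by auto
  then show ?thesis by simp
next
  case False
  \<comment> \<open>Relative position of \<open>y\<close> in the interval from \<open>x\<close> to
    \<open>y + d\<close>; that of \<open>x + d\<close> is \<open>1 - s\<close>.\<close>
  define s where "s = (y - x) / (y - x + d)"
  have s: "0 \<le> s" "s \<le> 1" using assms False by (auto simp: s_def field_simps)
  have e: "s * (y - x + d) = y - x" using False by (simp add: s_def)
  have y: "(1 - s) *\<^sub>R x + s *\<^sub>R (y + d) = y" using e by (simp add: algebra_simps)
  have x: "(1 - (1 - s)) *\<^sub>R x + (1 - s) *\<^sub>R (y + d) = x + d" using e by (simp add: algebra_simps)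
  have "f y \<ge> (1 - s) * f x + s * f (y + d)"
    using concave_onD[OF assms(1), of s x "y + d"] s assms unfolding y by auto
  moreover have "f (x + d) \<ge> s * f x + (1 - s) * f (y + d)"
    using concave_onD[OF assms(1), of "1 - s" x "y + d"] s assms unfolding x by auto
  ultimately show ?thesis by (simp add: algebra_simps)
qed

text \<open>For \<open>b \<le> T\<close> this is the decrease of the increments of the concave
  \<open>CU\<close>. For \<open>b = Suc T\<close> the gaps ending at \<open>b\<close> are free, and
  monotonicity of \<open>CU\<close> suffices if \<open>b' \<le> T\<close>; otherwise all four terms
  are 0.\<close>

lemma monge_gap_cost:
  assumes uc: "uc_data T L PDT CU"
  shows "monge (Suc T) (gap_cost T L PDT CU)"
  unfolding monge_def
proof (intro allI impI, elim conjE)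
  fix a a' b' b
  assume as: "a \<le> a'" "a' < b'" "b' \<le> b" "b \<le> Suc T"
  let ?S = "period_start L PDT" and ?F = "period_end L PDT" and ?G = "gap_cost T L PDT CU"
  show "?G a' b' + ?G a b \<le> ?G a b' + ?G a' b"
  proof (cases "b \<le> T")
    case True
    have "?F a \<le> ?F a'" "?F a' \<le> ?S b'" "?S b' \<le> ?S b"
      using as True by (auto intro!: period_end_mono[OF uc] period_end_le_start[OF uc] period_start_mono[OF uc])
    then have "CU ((?S b' - ?F a) + (?S b - ?S b')) + CU (?S b' - ?F a') \<le>
        CU ((?S b' - ?F a') + (?S b - ?S b')) + CU (?S b' - ?F a)"
      using uc by (intro concave_increment_antimono) (auto simp: uc_data_def)
    then show ?thesis using as True by (simp add: gap_cost_eq)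
  next
    case False
    show ?thesis
    proof (cases "b' \<le> T")
      case True
      have "?F a \<le> ?F a'" "?F a' \<le> ?S b'"
        using as True by (auto intro!: period_end_mono[OF uc] period_end_le_start[OF uc])
      then have "CU (?S b' - ?F a') \<le> CU (?S b' - ?F a)"
        using uc by (auto simp: uc_data_def intro: mono_onD)
      then show ?thesis using as True False by (simp add: gap_cost_eq) (simp add: gap_cost_def)
    next
      case b': False
      with False show ?thesis by (simp add: gap_cost_def)
    qed
  qed
qed

section \<open>The start-up cost of a binary schedule as a path cost\<close>

lemma ol_eq:
  assumes "\<forall>t\<in>{1..n}. Poly_Mapping.lookup v t \<in> {0, 1}"
  shows "ol (Suc n) v = n - last (0 # filter (\<lambda>t. Poly_Mapping.lookup v t = 1) [1..<Suc n])"
proof -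
  define on where "on = filter (\<lambda>t. Poly_Mapping.lookup v t = 1) [1..<Suc n]"
  \<comment> \<open>Prepending 0 makes the time before the model the last operational period when
    none of the periods up to \<open>n\<close> is on.\<close>
  define m where "m = last (0 # on)"
  have "m \<in> set (0 # on)" unfolding m_def by (rule last_in_set) simp
  then have m: "m = 0 \<or> (1 \<le> m \<and> m \<le> n \<and> Poly_Mapping.lookup v m = 1)"
    by (auto simp: on_def)
  have sorted: "sorted (0 # on)" by (simp add: on_def sorted_wrt_filter del: upt_Suc)
  have le_m: "t \<le> m" if "t \<in> set on" for t
  proof -
    have "sorted (butlast (0 # on) @ [m])" using sorted unfolding m_def by simp
    moreover have "t \<in> set (butlast (0 # on) @ [m])" using that unfolding m_def
      by (metis append_butlast_last_id list.distinct(1) list.set_intros(2))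
    ultimately show ?thesis by (metis empty_iff empty_set in_set_conv_decomp order.refl set_append
          set_ConsD sorted_append Un_iff list.set_intros(1))
  qed
  have off: "Poly_Mapping.lookup v t = 0" if "m < t" "t \<le> n" for t
  proof (rule ccontr)
    assume "Poly_Mapping.lookup v t \<noteq> 0"
    with that assms have "t \<in> set on" by (auto simp: on_def simp del: upt_Suc)
    with le_m that show False by fastforce
  qed
  have "Max {l \<in> {0..n}. \<forall>j\<in>{1..l}. Poly_Mapping.lookup v (Suc n - j) = 0} = n - m"
  proof (rule Max_eqI)
    fix l assume l: "l \<in> {l \<in> {0..n}. \<forall>j\<in>{1..l}. Poly_Mapping.lookup v (Suc n - j) = 0}"
    show "l \<le> n - m"
    proof (rule ccontr)
      assume "\<not> l \<le> n - m"
      with l m have m1: "1 \<le> m" "m \<le> n" "Poly_Mapping.lookup v m = 1" by auto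
      then have "Suc n - m \<in> {1..l}" using \<open>\<not> l \<le> n - m\<close> by auto
      with l have "Poly_Mapping.lookup v (Suc n - (Suc n - m)) = 0" by blast
      with m1 show False by simp
    qed
  qed (auto intro!: off)
  then show ?thesis by (simp add: ol_def m_def on_def)
qed

text \<open>Induction over a growing horizon: a period that is on appends the edge from the previous
  operational period, one that is off appends nothing. The closing edge to \<open>Suc T\<close> is
  free.\<close>

lemma DCU_eq_path_cost:
  assumes "v \<in> binary_vectors T"
  shows "DCU T L PDT CU v =
    path_cost (gap_cost T L PDT CU) 0
      (filter (\<lambda>t. Poly_Mapping.lookup v t = 1) [Suc 0..<Suc T] @ [Suc T])"
proof -
  define on where "on = (\<lambda>n. filter (\<lambda>t. Poly_Mapping.lookup v t = 1) [1..<Suc n])"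
  have "(\<Sum>t=1..n. DCUt L PDT CU t v) = path_cost (gap_cost T L PDT CU) 0 (on n)"
    if "n \<le> T" for n
    using that
  proof (induction n)
    case 0
    then show ?case by (simp add: on_def)
  next
    case (Suc n)
    have "ol (Suc n) v = n - last (0 # on n)"
      unfolding on_def using assms Suc.prems by (intro ol_eq) (auto simp: binary_vectors_def)
    then have "DCUt L PDT CU (Suc n) v =
        (if Poly_Mapping.lookup v (Suc n) = 1 then gap_cost T L PDT CU (last (0 # on n)) (Suc n) else 0)"
      using Suc.prems by (simp add: DCUt_def gap_cost_def)
    moreover have "on (Suc n) = on n @ (if Poly_Mapping.lookup v (Suc n) = 1 then [Suc n] else [])"
      by (simp add: on_def)
    ultimately show ?case using Suc by (simp add: path_cost_append)
  qed
  from this[of T] show ?thesis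
    by (simp add: DCU_def path_cost_append on_def gap_cost_def)
qed

section \<open>The convex hull and its supporting inequalities\<close>

lemma lookup_scaleR: "Poly_Mapping.lookup (x *\<^sub>R v) t = x * Poly_Mapping.lookup v t"
  for v :: "'a \<Rightarrow>\<^sub>0 real"
proof -
  have "finite {i. x * Poly_Mapping.lookup v i \<noteq> 0}"
    by (rule finite_subset[OF _ finite_lookup[of v]]) auto
  then show ?thesis by (simp add: scaleR_poly_mapping_def)
qed

lemma convex_cube01: "convex (cube01 T)"
proof (rule convexI)
  fix v w :: "nat \<Rightarrow>\<^sub>0 real" and x y :: real
  assume as: "v \<in> cube01 T" "w \<in> cube01 T" "0 \<le> x" "0 \<le> y" "x + y = 1"
  have "Poly_Mapping.lookup (x *\<^sub>R v + y *\<^sub>R w) t \<in> {0..1}" if "t \<in> {1..T}" for t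
    using as that convex_bound_le[of "Poly_Mapping.lookup v t" 1 "Poly_Mapping.lookup w t" x y]
    by (auto simp: cube01_def lookup_add lookup_scaleR)
  moreover have "Poly_Mapping.keys (x *\<^sub>R v + y *\<^sub>R w) \<subseteq>
      Poly_Mapping.keys v \<union> Poly_Mapping.keys w"
    by (auto simp: in_keys_iff lookup_add lookup_scaleR)
  then have "Poly_Mapping.keys (x *\<^sub>R v + y *\<^sub>R w) \<subseteq> {1..T}"
    using as unfolding cube01_def by blast
  ultimately show "x *\<^sub>R v + y *\<^sub>R w \<in> cube01 T" by (simp add: cube01_def)
qed

lemma binary_subset_cube: "binary_vectors T \<subseteq> cube01 T"
  by (fastforce simp: binary_vectors_def cube01_def)

abbreviation DCU_hull where
  "DCU_hull T L PDT CU \<equiv> convex hull (epigraph (binary_vectors T) (DCU T L PDT CU))"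

text \<open>The tree inequalities are the supporting inequalities of the Lovasz extension of the
  submodular set function \<open>DCU\<close>.\<close>

lemma tree_sum_le_hull:
  assumes uc: "uc_data T L PDT CU" and B: "inorder B = [1..<Suc T]"
    and wd: "(w, d) \<in> DCU_hull T L PDT CU"
  shows "w \<in> cube01 T \<and>
    tree_sum (gap_cost T L PDT CU) 0 B (Suc T) (Poly_Mapping.lookup w) \<le> d"
proof -
  let ?f = "\<lambda>w. tree_sum (gap_cost T L PDT CU) 0 B (Suc T) (Poly_Mapping.lookup w)"
  let ?A = "epigraph (cube01 T) ?f"
  have "convex ?A"
  proof (rule convexI)
    fix p q :: "(nat \<Rightarrow>\<^sub>0 real) \<times> real" and x y :: real
    assume pq: "p \<in> ?A" "q \<in> ?A" "0 \<le> x" "0 \<le> y" "x + y = 1"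
    obtain v d w e where p: "p = (v, d)" and q: "q = (w, e)" by (cases p, cases q)
    have as: "v \<in> cube01 T" "?f v \<le> d" "w \<in> cube01 T" "?f w \<le> e" "0 \<le> x" "0 \<le> y" "x + y = 1"
      using pq by (auto simp: p q mem_epigraph)
    have "?f (x *\<^sub>R v + y *\<^sub>R w) = x * ?f v + y * ?f w"
      by (simp add: lookup_add lookup_scaleR[abs_def] tree_sum_combine
          plus_poly_mapping.rep_eq)
    moreover have "x * ?f v + y * ?f w \<le> x * d + y * e"
      using as by (intro add_mono mult_left_mono) auto
    moreover have "x *\<^sub>R v + y *\<^sub>R w \<in> cube01 T"
      using as convexD[OF convex_cube01] by blast
    ultimately show "x *\<^sub>R p + y *\<^sub>R q \<in> ?A" by (simp add: p q mem_epigraph)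
  qed
  moreover have "epigraph (binary_vectors T) (DCU T L PDT CU) \<subseteq> ?A"
  proof
    fix p assume "p \<in> epigraph (binary_vectors T) (DCU T L PDT CU)"
    then obtain w d where p: "p = (w, d)" and w: "w \<in> binary_vectors T"
      and d: "DCU T L PDT CU w \<le> d"
      by (cases p) (auto simp: mem_epigraph)
    have sorted: "sorted_wrt (<) (0 # inorder B @ [Suc T])"
      by (simp add: B sorted_wrt_append del: upt_Suc)
    have "set_tree B = {1..T}" using B by (metis set_inorder set_upt atLeastLessThanSuc_atLeastAtMost)
    then have "\<forall>t\<in>set_tree B. Poly_Mapping.lookup w t \<in> {0, 1}"
      using w by (auto simp: binary_vectors_def)
    from tree_sum_le_path_cost[OF monge_gap_cost[OF uc] sorted _ this]
    have "?f w + gap_cost T L PDT CU 0 (Suc T) \<le> DCU T L PDT CU w"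
      by (simp add: DCU_eq_path_cost[OF w] B del: upt_Suc)
    \<comment> \<open>The direct edge from 0 to \<open>Suc T\<close> is free, so the extra term of
      the path bound vanishes.\<close>
    then have "?f w \<le> d" using d by (simp add: gap_cost_def)
    then show "p \<in> ?A" using w binary_subset_cube by (auto simp: p mem_epigraph)
  qed
  ultimately have "DCU_hull T L PDT CU \<subseteq> ?A" by (intro hull_minimal)
  then show ?thesis using wd by (auto simp: mem_epigraph)
qed

text \<open>Peel off the smallest positive entry \<open>m\<close>: \<open>v\<close> is the
  combination of the indicator \<open>u\<close> of its support and a point \<open>w\<close> of
  smaller support, with weights \<open>m\<close> and \<open>1 - m\<close>. Both share the Cartesian
  tree of \<open>v\<close>, for which the tree sum is linear, and at binary points it equals
  \<open>DCU\<close>.\<close>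

lemma cartesian_tree_sum_in_hull:
  assumes "v \<in> cube01 T" "cartesian (Poly_Mapping.lookup v) 0 B (Suc T)"
  shows "(v, tree_sum (gap_cost T L PDT CU) 0 B (Suc T) (Poly_Mapping.lookup v))
    \<in> DCU_hull T L PDT CU"
  using assms
proof (induction "card (Poly_Mapping.keys v)" arbitrary: v rule: less_induct)
  case less
  let ?f = "\<lambda>w. tree_sum (gap_cost T L PDT CU) 0 B (Suc T) (Poly_Mapping.lookup w)"
  have B: "inorder B = [1..<Suc T]" "set_tree B = {1..T}"
    using less.prems(2) cartesian_inorder cartesian_set_tree by fastforce+
  have binary: "(w, ?f w) \<in> DCU_hull T L PDT CU"
    if w: "w \<in> binary_vectors T" and cart: "cartesian (Poly_Mapping.lookup w) 0 B (Suc T)" for w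
  proof -
    have "\<forall>t\<in>set_tree B. Poly_Mapping.lookup w t \<in> {0, 1}"
      using w B by (auto simp: binary_vectors_def)
    from tree_sum_eq_path_cost[OF cart this, of "gap_cost T L PDT CU"]
    have "?f w = DCU T L PDT CU w"
      by (simp add: DCU_eq_path_cost[OF w] B gap_cost_def[of _ _ _ _ 0] del: upt_Suc)
    then show ?thesis using w by (intro hull_inc) (simp add: mem_epigraph)
  qed
  show ?case
  proof (cases "v \<in> binary_vectors T")
    case True
    then show ?thesis using binary less.prems by blast
  next
    case False
    let ?K = "Poly_Mapping.keys v"
    define m where "m = Min (Poly_Mapping.lookup v ` ?K)"
    define u where "u = Poly_Mapping.map (\<lambda>_. 1 :: real) v"
    define w where "w = (1 / (1 - m)) *\<^sub>R (v - m *\<^sub>R u)"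
    have nn: "0 \<le> Poly_Mapping.lookup v t" for t
      using less.prems(1) by (cases "t \<in> ?K") (auto simp: cube01_def in_keys_iff)
    have le1: "Poly_Mapping.lookup v t \<le> 1" for t
      using less.prems(1) by (cases "t \<in> ?K") (auto simp: cube01_def in_keys_iff)
    have u: "Poly_Mapping.lookup u t = (if Poly_Mapping.lookup v t = 0 then 0 else 1)" for t
      by (simp add: u_def Poly_Mapping.map.rep_eq)
    \<comment> \<open>A point of the cube that is not binary has a positive entry below 1; this
      gives \<open>m < 1\<close> and makes the division by \<open>1 - m\<close> sound.\<close>
    obtain t1 where t1: "t1 \<in> ?K" "Poly_Mapping.lookup v t1 < 1"
    proof -
      have "\<exists>t\<in>?K. Poly_Mapping.lookup v t \<noteq> 1"
        using False less.prems(1) by (auto simp: binary_vectors_def cube01_def in_keys_iff)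
      then show thesis using that le1 by (metis order.strict_iff_order)
    qed
    have mle: "m \<le> Poly_Mapping.lookup v t" if "t \<in> ?K" for t
      unfolding m_def using that by simp
    have "m \<in> Poly_Mapping.lookup v ` ?K"
      unfolding m_def using t1 by (intro Min_in) auto
    then obtain t0 where t0: "t0 \<in> ?K" "Poly_Mapping.lookup v t0 = m" by blast
    have m: "0 < m" "m < 1" using t0 nn[of t0] t1 mle[OF t1(1)] by (auto simp: in_keys_iff)
    have w: "Poly_Mapping.lookup w t =
        (if Poly_Mapping.lookup v t = 0 then 0 else (Poly_Mapping.lookup v t - m) / (1 - m))" for t
      by (simp add: w_def lookup_scaleR lookup_minus u)
    have "Poly_Mapping.keys w \<subseteq> ?K" by (auto simp: in_keys_iff w)
    moreover have "t0 \<notin> Poly_Mapping.keys w" using t0 by (simp add: in_keys_iff w)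
    ultimately have "card (Poly_Mapping.keys w) < card ?K"
      using t0(1) by (intro psubset_card_mono) auto
    moreover have "w \<in> cube01 T"
    proof -
      have "Poly_Mapping.lookup w t \<in> {0..1}" for t
        using m mle[of t] le1[of t] by (auto simp: w in_keys_iff divide_simps)
      then show ?thesis using \<open>Poly_Mapping.keys w \<subseteq> ?K\<close> less.prems(1)
        unfolding cube01_def by blast
    qed
    moreover have "cartesian (Poly_Mapping.lookup w) 0 B (Suc T)"
    proof (rule cartesian_mono[OF less.prems(2)])
      fix x y assume "Poly_Mapping.lookup v y \<le> Poly_Mapping.lookup v x"
      then show "Poly_Mapping.lookup w y \<le> Poly_Mapping.lookup w x"
        using m mle[of x] mle[of y] nn[of x] nn[of y] by (auto simp: w in_keys_iff divide_simps)
    qed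
    ultimately have wh: "(w, ?f w) \<in> DCU_hull T L PDT CU" using less.hyps by blast
    have "cartesian (Poly_Mapping.lookup u) 0 B (Suc T)"
    proof (rule cartesian_mono[OF less.prems(2)])
      fix x y assume "Poly_Mapping.lookup v y \<le> Poly_Mapping.lookup v x"
      then show "Poly_Mapping.lookup u y \<le> Poly_Mapping.lookup u x"
        using nn[of x] nn[of y] by (auto simp: u)
    qed
    moreover have "u \<in> binary_vectors T"
      using less.prems(1) by (auto simp: binary_vectors_def cube01_def u subset_iff in_keys_iff split: if_splits)
    ultimately have uh: "(u, ?f u) \<in> DCU_hull T L PDT CU" using binary by blast
    have v: "v = m *\<^sub>R u + (1 - m) *\<^sub>R w" unfolding w_def using m by simp
    have "?f v = m * ?f u + (1 - m) * ?f w"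
      by (subst v) (simp add: lookup_scaleR[abs_def] tree_sum_combine plus_poly_mapping.rep_eq)
    then have "(v, ?f v) = m *\<^sub>R (u, ?f u) + (1 - m) *\<^sub>R (w, ?f w)" using v by simp
    moreover have "\<dots> \<in> DCU_hull T L PDT CU"
      by (rule convexD[OF convex_convex_hull uh wh]) (use m in auto)
    ultimately show ?thesis by (simp only:)
  qed
qed

text \<open>Raising the cost by \<open>e - d\<close> maps the generating epigraph into itself, and
  hulls commute with translations.\<close>

lemma DCU_hull_upward:
  assumes "(v, d) \<in> DCU_hull T L PDT CU" "d \<le> e"
  shows "(v, e) \<in> DCU_hull T L PDT CU"
proof -
  let ?S = "epigraph (binary_vectors T) (DCU T L PDT CU)"
  have "(\<lambda>p. (0, e - d) + p) ` ?S \<subseteq> ?S"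
    using assms(2) by (auto simp: epigraph_def)
  then have "convex hull ((\<lambda>p. (0, e - d) + p) ` ?S) \<subseteq> DCU_hull T L PDT CU"
    by (rule hull_mono)
  moreover have "(0, e - d) + (v, d) \<in> convex hull ((\<lambda>p. (0, e - d) + p) ` ?S)"
    unfolding convex_hull_translation using assms(1) by (rule imageI)
  ultimately show ?thesis by auto
qed

text \<open>Validity of the tree inequality gives one direction. For the other, the bound is
  attained at \<open>v\<close> and the hull is closed upwards.\<close>

lemma cartesian_hull_iff:
  assumes "uc_data T L PDT CU" "v \<in> cube01 T" "cartesian (Poly_Mapping.lookup v) 0 B (Suc T)"
  shows "(v, d) \<in> DCU_hull T L PDT CU \<longleftrightarrow>
    tree_sum (gap_cost T L PDT CU) 0 B (Suc T) (Poly_Mapping.lookup v) \<le> d"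
  using assms cartesian_inorder[OF assms(3)]
  by (metis One_nat_def DCU_hull_upward cartesian_tree_sum_in_hull tree_sum_le_hull)

text \<open>Justifies the definite description: a function with this epigraph exists, and its
  epigraph determines it on the cube, extensionality elsewhere.\<close>

lemma epigraph_LCU:
  assumes uc: "uc_data T L PDT CU"
  shows "epigraph (cube01 T) (LCU T L PDT CU) = DCU_hull T L PDT CU"
proof -
  \<comment> \<open>The tree is chosen anew for every point, so \<open>F\<close> is the Lovasz
    extension and not one linear function.\<close>
  let ?tree = "\<lambda>v :: nat \<Rightarrow>\<^sub>0 real. SOME B. cartesian (Poly_Mapping.lookup v) 0 B (Suc T)"
  have tree: "cartesian (Poly_Mapping.lookup v) 0 (?tree v) (Suc T)" for v
    by (rule someI_ex[OF cartesian_exists]) simp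
  define F where "F = restrict (\<lambda>v. tree_sum (gap_cost T L PDT CU) 0 (?tree v) (Suc T)
    (Poly_Mapping.lookup v)) (cube01 T)"
  have F: "epigraph (cube01 T) F = DCU_hull T L PDT CU"
  proof (rule set_eqI, clarify)
    fix v d
    have "v \<in> cube01 T" if "(v, d) \<in> DCU_hull T L PDT CU"
      using tree_sum_le_hull[OF uc _ that, of "?tree v"] cartesian_inorder[OF tree, of v] by simp
    then show "(v, d) \<in> epigraph (cube01 T) F \<longleftrightarrow> (v, d) \<in> DCU_hull T L PDT CU"
      using cartesian_hull_iff[OF uc _ tree, of v d] by (auto simp: mem_epigraph F_def)
  qed
  have "\<exists>!f. f \<in> extensional (cube01 T) \<and> epigraph (cube01 T) f = DCU_hull T L PDT CU"
  proof (rule ex1I[of _ F])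
    show "F \<in> extensional (cube01 T) \<and> epigraph (cube01 T) F = DCU_hull T L PDT CU"
      using F by (simp add: F_def)
  next
    fix f assume f: "f \<in> extensional (cube01 T) \<and> epigraph (cube01 T) f = DCU_hull T L PDT CU"
    show "f = F"
    proof (rule extensionalityI)
      show "f \<in> extensional (cube01 T)" using f by simp
      show "F \<in> extensional (cube01 T)" by (simp add: F_def)
    next
      fix v assume v: "v \<in> cube01 T"
      have "(v, d) \<in> epigraph (cube01 T) f \<longleftrightarrow> (v, d) \<in> epigraph (cube01 T) F" for d
        using f F by simp
      then have "f v \<le> d \<longleftrightarrow> F v \<le> d" for d using v by (simp add: mem_epigraph)
      then show "f v = F v" by (metis order.antisym order.refl)
    qed
  qed
  from theI'[OF this] show ?thesis unfolding LCU_def by blast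
qed

text \<open>A node \<open>t\<close> whose subtree covers the labels strictly between
  \<open>a\<close> and \<open>b\<close> has subtree sizes \<open>t - a - 1\<close> and
  \<open>b - t - 1\<close>. Thus \<open>t + r + 1\<close> is \<open>b\<close>, and the case
  \<open>t + r = T\<close> of \<open>delta\<close> is \<open>b = Suc T\<close>.\<close>

lemma carries_tree_coeffs:
  assumes "cartesian v 0 B (Suc T)" "carries (gap_cost T L PDT CU) \<alpha> 0 B (Suc T)"
  shows "tree_coeffs T L PDT CU B \<alpha>"
proof -
  have "\<alpha> t = delta T L PDT CU t (size l) (size r)"
    if "cartesian v a C b" "carries (gap_cost T L PDT CU) \<alpha> a C b" "b \<le> Suc T"
      "\<langle>l, t, r\<rangle> \<in> subtrees C" for a C b l t r
    using that
  proof (induction C arbitrary: a b)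
    case Leaf
    then show ?case by simp
  next
    case (Node l' x r')
    have "a < x" "x < b" using Node.prems(1) cartesian_inorder by auto
    have "\<alpha> x = delta T L PDT CU x (size l') (size r')"
      using Node.prems \<open>a < x\<close> \<open>x < b\<close>
      by (auto simp: cartesian_size delta_def gap_cost_def Suc_diff_Suc)
    then show ?case using Node \<open>a < x\<close> \<open>x < b\<close> by auto
  qed
  then show ?thesis using assms by (auto simp: tree_coeffs_def)
qed

section \<open>Building the Cartesian tree with a stack\<close>

text \<open>The stack contains the pending nodes, i.e. those whose right subtree is still growing;
  \<open>prev x\<close> is both the element below \<open>x\<close> on the stack and the left end of the interval covered
  by the subtree of \<open>x\<close>.\<close>

primrec stack ::
  "(nat \<Rightarrow> nat \<Rightarrow> real) \<Rightarrow> (nat \<Rightarrow> real) \<Rightarrow> (nat \<Rightarrow> nat) \<Rightarrow> (nat \<Rightarrow> real) \<Rightarrow> nat list \<Rightarrow> nat \<Rightarrow> bool"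
  where
  "stack E v prev \<alpha> [] p \<longleftrightarrow> p = 0"
| "stack E v prev \<alpha> (x # xs) p \<longleftrightarrow> p = x \<and> prev x < x \<and>
     (\<exists>A. cartesian v (prev x) A x \<and> carries E \<alpha> (prev x) A x \<and> (\<forall>y\<in>set_tree A. v y \<le> v x)) \<and>
     (0 < prev x \<longrightarrow> v x \<le> v (prev x)) \<and> stack E v prev \<alpha> xs (prev x)"

lemma stack_subset: "stack E v prev \<alpha> xs p \<Longrightarrow> set xs \<subseteq> {1..p}"
  by (induction xs arbitrary: p) fastforce+

text \<open>A frame property: a push writes \<open>prev\<close> above the old top, and a pop writes
  the coefficient array above the new top.\<close>

lemma stack_cong:
  assumes "stack E v prev \<alpha> xs p" "\<And>y. y \<le> p \<Longrightarrow> prev' y = prev y \<and> \<alpha>' y = \<alpha> y"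
  shows "stack E v prev' \<alpha>' xs p"
  using assms
proof (induction xs arbitrary: p)
  case Nil
  then show ?case by simp
next
  case (Cons x xs)
  have x: "p = x" "prev x < x" "prev' x = prev x" "0 < prev x \<longrightarrow> v x \<le> v (prev x)"
    using Cons.prems by auto
  obtain A where A: "cartesian v (prev x) A x" "carries E \<alpha> (prev x) A x"
    "\<forall>y\<in>set_tree A. v y \<le> v x"
    using Cons.prems(1) by auto
  have "carries E \<alpha>' (prev x) A x"
    using A(2) by (rule carries_cong) (use A(1) Cons.prems(2) x in \<open>auto simp: cartesian_set_tree\<close>)
  moreover have "stack E v prev' \<alpha>' xs (prev x)"
    using Cons.prems x by (intro Cons.IH) auto
  ultimately show ?case using x A by auto
qed

text \<open>The finished tree \<open>C\<close> fills the gap between the top \<open>p\<close> and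
  the next period \<open>t\<close>. It becomes the right subtree of \<open>p\<close> on a pop and
  the left subtree of \<open>t\<close> on a push, hence the two heap bounds. The value
  \<open>z\<close> sums the terms of all nodes already popped.\<close>

definition scan_state ::
  "(nat \<Rightarrow> nat \<Rightarrow> real) \<Rightarrow> (nat \<Rightarrow> real) \<Rightarrow> nat \<Rightarrow> nat \<Rightarrow> nat \<Rightarrow> (nat \<Rightarrow> nat) \<Rightarrow> (nat \<Rightarrow> real) \<Rightarrow> real
    \<Rightarrow> nat list \<Rightarrow> bool" where
  "scan_state E v T t p prev \<alpha> z xs \<longleftrightarrow>
     1 \<le> t \<and> t \<le> Suc T \<and> p < t \<and> stack E v prev \<alpha> xs p \<and>
     (\<exists>C. cartesian v p C t \<and> carries E \<alpha> p C t \<and> (t \<le> T \<longrightarrow> (\<forall>y\<in>set_tree C. v y \<le> v t)) \<and>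
       (0 < p \<longrightarrow> (\<forall>y\<in>set_tree C. v y \<le> v p))) \<and>
     z = (\<Sum>y\<in>{1..<t} - set xs. \<alpha> y * v y)"

lemma scan_state_init: "scan_state E v T (Suc 0) 0 prev \<alpha> 0 []"
  unfolding scan_state_def by (auto intro: exI[of _ "\<langle>\<rangle>"])

lemma scan_state_stack:
  assumes "scan_state E v T t p prev \<alpha> z xs" "0 < p"
  shows "xs = p # tl xs \<and> prev p < p"
  using assms by (cases xs) (auto simp: scan_state_def)

text \<open>Popping fixes the interval of \<open>p\<close>, with ends \<open>prev p\<close> and
  \<open>t\<close>, so \<open>e\<close> is its final coefficient. The stored left subtree and the
  gap tree are joined below \<open>p\<close> and become the new gap tree.\<close>

lemma scan_state_pop:
  assumes st: "scan_state E v T t p prev \<alpha> z xs" and p: "0 < p" "t \<le> T \<Longrightarrow> v p < v t"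
    and e: "e = E (prev p) p + E p t - E (prev p) t"
  shows "scan_state E v T t (prev p) prev (\<alpha>(p := e)) (z + e * v p) (tl xs)"
proof -
  obtain ys where xs: "xs = p # ys" and lp: "prev p < p"
    using scan_state_stack[OF st p(1)] by auto
  have t: "1 \<le> t" "t \<le> Suc T" "p < t" and stk: "stack E v prev \<alpha> (p # ys) p"
    and z: "z = (\<Sum>y\<in>{1..<t} - set xs. \<alpha> y * v y)"
    using st by (auto simp: scan_state_def xs)
  obtain C where C: "cartesian v p C t" "carries E \<alpha> p C t" "\<forall>y\<in>set_tree C. v y \<le> v p"
    using st p(1) by (auto simp: scan_state_def)
  obtain A where A: "cartesian v (prev p) A p" "carries E \<alpha> (prev p) A p"
    "\<forall>y\<in>set_tree A. v y \<le> v p"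
    using stk by auto
  have up: "0 < prev p \<longrightarrow> v p \<le> v (prev p)" using stk by simp
  have ys: "stack E v prev \<alpha> ys (prev p)" using stk by simp
  have "stack E v prev (\<alpha>(p := e)) ys (prev p)"
    using ys by (rule stack_cong) (use lp in auto)
  moreover have "carries E (\<alpha>(p := e)) (prev p) \<langle>A, p, C\<rangle> t"
    using carries_cong[OF A(2)] carries_cong[OF C(2)] A(1) C(1) e
    by (auto simp: cartesian_set_tree)
  moreover have "cartesian v (prev p) \<langle>A, p, C\<rangle> t" using A C by auto
  moreover have "\<forall>y\<in>set_tree \<langle>A, p, C\<rangle>. v y \<le> v p" using A(3) C(3) by auto
  moreover have "z + e * v p = (\<Sum>y\<in>{1..<t} - set ys. (\<alpha>(p := e)) y * v y)"
  proof -
    have "p \<notin> set ys" using stack_subset[OF ys] lp by auto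
    then have "{1..<t} - set ys = insert p ({1..<t} - set xs)" using p t by (auto simp: xs)
    moreover have "(\<Sum>y\<in>{1..<t} - set xs. (\<alpha>(p := e)) y * v y) = z"
      unfolding z by (rule sum.cong) (auto simp: xs)
    moreover have "p \<notin> {1..<t} - set xs" by (simp add: xs)
    ultimately show ?thesis by simp
  qed
  moreover have "\<forall>y\<in>set_tree \<langle>A, p, C\<rangle>. v y \<le> v t" if "t \<le> T"
    using \<open>\<forall>y\<in>set_tree \<langle>A, p, C\<rangle>. v y \<le> v p\<close> p(2)[OF that] by (meson less_imp_le order_trans)
  moreover have "\<forall>y\<in>set_tree \<langle>A, p, C\<rangle>. v y \<le> v (prev p)" if "0 < prev p"
    using \<open>\<forall>y\<in>set_tree \<langle>A, p, C\<rangle>. v y \<le> v p\<close> up that by (meson order_trans)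
  moreover have "prev p < t" using lp t by simp
  ultimately show ?thesis using t(1,2) unfolding scan_state_def xs list.sel
    by (intro conjI impI exI[of _ "\<langle>A, p, C\<rangle>"]) assumption+
qed

text \<open>The gap tree becomes the left subtree of \<open>t\<close>, and the new gap between
  \<open>t\<close> and \<open>Suc t\<close> is empty.\<close>

lemma scan_state_push:
  assumes st: "scan_state E v T t p prev \<alpha> z xs" and t: "t \<le> T" "0 < p \<Longrightarrow> v t \<le> v p"
  shows "scan_state E v T (Suc t) t (prev(t := p)) \<alpha> z (t # xs)"
proof -
  have stk: "stack E v prev \<alpha> xs p" and "p < t" "1 \<le> t"
    using st by (auto simp: scan_state_def)
  have "stack E v (prev(t := p)) \<alpha> xs p"
    using stk by (rule stack_cong) (use \<open>p < t\<close> in auto)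
  moreover obtain A where "cartesian v p A t" "carries E \<alpha> p A t" "\<forall>y\<in>set_tree A. v y \<le> v t"
    using st t(1) by (auto simp: scan_state_def)
  ultimately have "stack E v (prev(t := p)) \<alpha> (t # xs) t" using \<open>p < t\<close> t(2) by auto
  moreover have "cartesian v t \<langle>\<rangle> (Suc t)" "carries E \<alpha> t \<langle>\<rangle> (Suc t)"
    "\<And>b. \<forall>y\<in>set_tree \<langle>\<rangle>. v y \<le> v b" by simp_all
  moreover have "{1..<Suc t} - set (t # xs) = {1..<t} - set xs" by auto
  then have "z = (\<Sum>y\<in>{1..<Suc t} - set (t # xs). \<alpha> y * v y)"
    using st by (simp only: scan_state_def)
  ultimately show ?thesis using t(1) unfolding scan_state_def
    by (intro conjI impI exI[of _ "\<langle>\<rangle>"]) (simp only: | simp)+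
qed

section \<open>The program\<close>

definition runs ::
  "(real \<Rightarrow> real) \<Rightarrow> (real \<Rightarrow> nat) \<Rightarrow> com \<Rightarrow> mem \<Rightarrow> (nat \<Rightarrow> mem \<Rightarrow> bool) \<Rightarrow> bool" where
  "runs CU \<tau> p s Q \<longleftrightarrow> (\<exists>n s'. exec CU \<tau> p s n s' \<and> Q n s')"

text \<open>Determinism turns the existential in \<open>runs\<close> into an equivalence, so
  straight-line code can be executed by rewriting.\<close>

lemma runs_exec:
  assumes "exec CU \<tau> p s n s'"
  shows "runs CU \<tau> p s Q \<longleftrightarrow> Q n s'"
proof
  assume "runs CU \<tau> p s Q"
  then obtain m s'' where "exec CU \<tau> p s m s''" "Q m s''" unfolding runs_def by blast
  with exec_deterministic[OF assms] show "Q n s'" by blast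
next
  assume "Q n s'"
  with assms show "runs CU \<tau> p s Q" unfolding runs_def by blast
qed

lemmas runs_simps = runs_exec[OF exec.Skip] runs_exec[OF exec.NWrite] runs_exec[OF exec.RWrite]

lemma runs_Seq:
  "runs CU \<tau> (Seq p q) s Q \<longleftrightarrow> runs CU \<tau> p s (\<lambda>m s'. runs CU \<tau> q s' (\<lambda>n. Q (m + n)))"
proof
  assume "runs CU \<tau> (Seq p q) s Q"
  then obtain n s' where "exec CU \<tau> (Seq p q) s n s'" "Q n s'" by (auto simp: runs_def)
  then show "runs CU \<tau> p s (\<lambda>m s'. runs CU \<tau> q s' (\<lambda>n. Q (m + n)))"
    by (elim SeqE) (auto simp: runs_exec)
next
  assume "runs CU \<tau> p s (\<lambda>m s'. runs CU \<tau> q s' (\<lambda>n. Q (m + n)))"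
  then obtain m s' n s'' where "exec CU \<tau> p s m s'" "exec CU \<tau> q s' n s''" "Q (m + n) s''"
    by (auto simp: runs_def)
  then show "runs CU \<tau> (Seq p q) s Q" by (simp add: runs_exec[OF exec.Seq])
qed

lemma runs_If:
  "runs CU \<tau> (If b p q) s Q \<longleftrightarrow>
     runs CU \<tau> (if bval CU s b then p else q) s (\<lambda>n. Q (bcost CU \<tau> s b + n + 1))"
proof
  assume "runs CU \<tau> (If b p q) s Q"
  then obtain n s' where "exec CU \<tau> (If b p q) s n s'" "Q n s'" by (auto simp: runs_def)
  then show "runs CU \<tau> (if bval CU s b then p else q) s (\<lambda>n. Q (bcost CU \<tau> s b + n + 1))"
    by (elim IfE) (auto simp: runs_exec)
next
  assume "runs CU \<tau> (if bval CU s b then p else q) s (\<lambda>n. Q (bcost CU \<tau> s b + n + 1))"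
  then obtain n s' where "exec CU \<tau> (if bval CU s b then p else q) s n s'"
    "Q (bcost CU \<tau> s b + n + 1) s'"
    by (auto simp: runs_def)
  then show "runs CU \<tau> (If b p q) s Q"
    by (cases "bval CU s b") (simp_all add: runs_exec[OF exec.IfTrue] runs_exec[OF exec.IfFalse])
qed

lemma runs_mono:
  "runs CU \<tau> p s Q \<Longrightarrow> (\<And>n s'. Q n s' \<Longrightarrow> R n s') \<Longrightarrow> runs CU \<tau> p s R"
  unfolding runs_def by blast

text \<open>The index \<open>k\<close> is a potential that every iteration lowers. One iteration
  costs at most \<open>c\<close> for test and loop overhead plus \<open>d\<close> for the body; the
  extra \<open>c\<close> pays for the failing test.\<close>

lemma runs_While:
  assumes test: "\<And>k s. I k s \<Longrightarrow> bcost CU \<tau> s b + 1 \<le> c"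
    and body: "\<And>k s. I k s \<Longrightarrow> bval CU s b \<Longrightarrow> runs CU \<tau> p s (\<lambda>n s'. n \<le> d \<and> (\<exists>k'<k. I k' s'))"
    and "I k s"
  shows "runs CU \<tau> (While b p) s (\<lambda>n s'. n \<le> (c + d) * k + c \<and> (\<exists>k'. I k' s') \<and> \<not> bval CU s' b)"
  using \<open>I k s\<close>
proof (induction k arbitrary: s rule: less_induct)
  case (less k)
  show ?case
  proof (cases "bval CU s b")
    case False
    then show ?thesis unfolding runs_def
      using exec.WhileFalse[OF False, of \<tau> p] test[OF less.prems] less.prems
      by (intro exI[of _ "bcost CU \<tau> s b + 1"] exI[of _ s]) (auto intro: trans_le_add2)
  next
    case True
    obtain m s' k' where 1: "exec CU \<tau> p s m s'" "m \<le> d" "k' < k" "I k' s'"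
      using body[OF less.prems True] by (auto simp: runs_def)
    obtain n s'' where 2: "exec CU \<tau> (While b p) s' n s''" "n \<le> (c + d) * k' + c"
      "\<exists>k'. I k' s''" "\<not> bval CU s'' b"
      using less.IH[OF 1(3,4)] by (auto simp: runs_def)
    have "bcost CU \<tau> s b + m + n + 1 \<le> (c + d) * Suc k' + c"
      using test[OF less.prems] 1(2) 2(2) by simp
    also have "\<dots> \<le> (c + d) * k + c" using 1(3) by (intro add_right_mono mult_le_mono2) simp
    finally show ?thesis unfolding runs_def
      using exec.WhileTrue[OF True 1(1) 2(1)] 2(3,4) by blast
  qed
qed

section \<open>The stack program\<close>

abbreviation nvar :: "string \<Rightarrow> nexp" where "nvar x \<equiv> NRead x (NNum 0)"
abbreviation rvar :: "string \<Rightarrow> rexp" where "rvar x \<equiv> RRead x (NNum 0)"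

text \<open>For \<open>t > T\<close> the second assignment is skipped because both remaining gaps
  reach the end of the horizon and are free.\<close>

definition pop :: com where
  "pop =
     Seq (RWrite ''alpha'' (nvar ''p'')
       (REvalCU (RSub (RRead ''start'' (nvar ''p'')) (RRead ''end'' (NRead ''prev'' (nvar ''p''))))))
    (Seq (If (NLess (nvar ''T'') (nvar ''t'')) Skip
       (RWrite ''alpha'' (nvar ''p'')
         (RSub
           (RAdd (RRead ''alpha'' (nvar ''p''))
             (REvalCU (RSub (RRead ''start'' (nvar ''t'')) (RRead ''end'' (nvar ''p'')))))
           (REvalCU (RSub (RRead ''start'' (nvar ''t''))
             (RRead ''end'' (NRead ''prev'' (nvar ''p''))))))))
    (Seq (RWrite ''sum'' (NNum 0)
       (RAdd (rvar ''sum'') (RMul (RRead ''alpha'' (nvar ''p'')) (RRead ''v'' (nvar ''p'')))))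
    (NWrite ''p'' (NNum 0) (NRead ''prev'' (nvar ''p'')))))"

text \<open>Also extends the two time tables: at the last assignment \<open>p\<close> is the period
  just pushed, and its end is the start of the new \<open>t\<close>.\<close>

definition push :: com where
  "push =
     Seq (NWrite ''prev'' (nvar ''t'') (nvar ''p''))
    (Seq (NWrite ''p'' (NNum 0) (nvar ''t''))
    (Seq (RWrite ''end'' (nvar ''t'')
       (RAdd (RRead ''start'' (nvar ''t'')) (RRead ''L'' (nvar ''t''))))
    (Seq (NWrite ''t'' (NNum 0) (NAdd (nvar ''t'') (NNum 1)))
    (RWrite ''start'' (nvar ''t'') (RRead ''end'' (nvar ''p''))))))"

text \<open>For \<open>t = T + 1\<close> the comparison with \<open>v t\<close> reads an arbitrary value, which is ignored.\<close>

definition scan_test :: bexp where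
  "scan_test = NLess (NNum 0) (NAdd (nvar ''p'') (NSub (NAdd (nvar ''T'') (NNum 1)) (nvar ''t'')))"

text \<open>Negated conjunctions express the disjunction that the periods are exhausted or
  \<open>v p < v t\<close>. Equal values are pushed, which the weak heap order permits.\<close>

definition pop_test :: bexp where
  "pop_test =
     BAnd (NLess (NNum 0) (nvar ''p''))
       (BNot (BAnd (BNot (NLess (nvar ''T'') (nvar ''t'')))
         (BNot (RLess (RRead ''v'' (nvar ''p'')) (RRead ''v'' (nvar ''t''))))))"

definition init :: com where
  "init =
     Seq (NWrite ''t'' (NNum 0) (NNum 1))
    (Seq (NWrite ''p'' (NNum 0) (NNum 0))
    (Seq (RWrite ''sum'' (NNum 0) (RNum 0))
    (Seq (RWrite ''start'' (NNum 1) (rvar ''PDT''))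
    (RWrite ''end'' (NNum 0) (RNum 0)))))"

definition answer :: com where
  "answer =
     If (RLess (rvar ''c'') (rvar ''sum''))
       (NWrite ''member'' (NNum 0) (NNum 0))
       (NWrite ''member'' (NNum 0) (NNum 1))"

definition separation :: com where
  "separation = Seq init (Seq (While scan_test (If pop_test pop push)) answer)"

section \<open>Correctness and step bounds of the program\<close>

lemma nats_reals_write [simp]:
  "nats (nwrite x i k s) = (nats s)(x := (nats s x)(i := k))"
  "reals (nwrite x i k s) = reals s"
  "reals (rwrite x i a s) = (reals s)(x := (reals s x)(i := a))"
  "nats (rwrite x i a s) = nats s"
  by (simp_all add: nwrite_def rwrite_def)

text \<open>The list \<open>xs\<close> is a ghost variable; in memory the stack is only the chain of
  \<open>prev\<close> links starting at \<open>p\<close>.\<close>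

definition scan_inv ::
  "nat \<Rightarrow> (nat \<Rightarrow> real) \<Rightarrow> real \<Rightarrow> (real \<Rightarrow> real) \<Rightarrow> (nat \<Rightarrow>\<^sub>0 real) \<Rightarrow> real \<Rightarrow> nat list \<Rightarrow> mem \<Rightarrow> bool" where
  "scan_inv T L PDT CU v c xs s \<longleftrightarrow> is_input s T L PDT v c \<and>
     scan_state (gap_cost T L PDT CU) (Poly_Mapping.lookup v) T (nats s ''t'' 0) (nats s ''p'' 0)
       (nats s ''prev'') (reals s ''alpha'') (reals s ''sum'' 0) xs \<and>
     (\<forall>j\<in>{1..nats s ''t'' 0}. reals s ''start'' j = period_start L PDT j) \<and>
     (\<forall>j<nats s ''t'' 0. reals s ''end'' j = period_end L PDT j)"

lemma runs_init:
  assumes "is_input s T L PDT v c" "uc_data T L PDT CU"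
  shows "runs CU \<tau> init s (\<lambda>n s'. n \<le> 50 \<and> nats s' ''t'' 0 = 1 \<and> scan_inv T L PDT CU v c [] s')"
  using assms scan_state_init
  by (simp add: init_def runs_simps runs_Seq runs_If scan_inv_def is_input_def period_start_def period_end_def)

text \<open>The summand \<open>3 * \<kappa>\<close> covers the at most three evaluations of
  \<open>CU\<close> in one coefficient.\<close>

lemma runs_pop:
  assumes inv: "scan_inv T L PDT CU v c xs s" and uc: "uc_data T L PDT CU"
    and \<tau>: "\<forall>x\<ge>0. \<tau> x \<le> \<kappa>"
    and p: "0 < nats s ''p'' 0"
    and top: "nats s ''t'' 0 \<le> T \<Longrightarrow>
      Poly_Mapping.lookup v (nats s ''p'' 0) < Poly_Mapping.lookup v (nats s ''t'' 0)"
  shows "runs CU \<tau> pop s (\<lambda>n s'. n \<le> 100 + 3 * \<kappa> \<and> nats s' ''t'' 0 = nats s ''t'' 0 \<and>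
      scan_inv T L PDT CU v c (tl xs) s')"
proof -
  define t x a where "t = nats s ''t'' 0" and "x = nats s ''p'' 0" and "a = nats s ''prev'' x"
  let ?E = "gap_cost T L PDT CU"
  have st: "scan_state ?E (Poly_Mapping.lookup v) T t x
         (nats s ''prev'') (reals s ''alpha'') (reals s ''sum'' 0) xs"
    using inv by (auto simp: scan_inv_def t_def x_def)
  have inp: "is_input s T L PDT v c" using inv by (simp add: scan_inv_def)
  have xs: "xs = x # tl xs" and ax: "a < x" using scan_state_stack[OF st] p
    by (auto simp: x_def a_def)
  have x: "0 < x" "x < t" "t \<le> Suc T" using st p by (auto simp: scan_state_def x_def)
  have start: "reals s ''start'' j = period_start L PDT j" if "1 \<le> j" "j \<le> t" for j
    using inv that by (simp add: scan_inv_def t_def)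
  have finish: "reals s ''end'' j = period_end L PDT j" if "j < t" for j
    using inv that by (simp add: scan_inv_def t_def)
  define e where "e = ?E a x + ?E x t - ?E a t"
  have st': "scan_state ?E (Poly_Mapping.lookup v) T t a (nats s ''prev'')
      ((reals s ''alpha'')(x := e)) (reals s ''sum'' 0 + e * Poly_Mapping.lookup v x) (tl xs)"
    unfolding a_def
    by (rule scan_state_pop[OF st x(1)]) (use top in \<open>auto simp: e_def a_def t_def x_def\<close>)
  have vx: "reals s ''v'' x = Poly_Mapping.lookup v x" using inp x by (simp add: is_input_def)
  have ax0: "?E a x = CU (reals s ''start'' x - reals s ''end'' a)"
    using ax x by (simp add: start finish gap_cost_eq)
  \<comment> \<open>The cost of evaluating \<open>CU\<close> is bounded only at nonnegative
    arguments, so offline times must be seen to be nonnegative.\<close>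
  have \<tau>1: "\<tau> (reals s ''start'' x - reals s ''end'' a) \<le> \<kappa>"
    using ax x period_end_le_start[OF uc ax] \<tau> by (simp add: start finish)
  have inT: "nats s ''T'' 0 = T" using inp by (simp add: is_input_def)
  show ?thesis
  proof (cases "T < t")
    case True
    then have e: "e = CU (reals s ''start'' x - reals s ''end'' a)"
      using ax0 by (simp add: e_def gap_cost_def)
    show ?thesis
      using inv True st' \<tau>1 e vx
      by (auto simp: pop_def runs_simps runs_Seq runs_If scan_inv_def is_input_def
          t_def[symmetric] x_def[symmetric] a_def[symmetric])
  next
    case False
    have xt: "?E x t = CU (reals s ''start'' t - reals s ''end'' x)"
      and at: "?E a t = CU (reals s ''start'' t - reals s ''end'' a)"
      using False ax x by (simp_all add: start finish gap_cost_eq)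
    have \<tau>2: "\<tau> (reals s ''start'' t - reals s ''end'' x) \<le> \<kappa>"
      using False x period_end_le_start[OF uc x(2)] \<tau> by (simp add: start finish)
    have \<tau>3: "\<tau> (reals s ''start'' t - reals s ''end'' a) \<le> \<kappa>"
      using False ax x period_end_le_start[OF uc, of a t] \<tau> by (simp add: start finish)
    have e: "CU (reals s ''start'' x - reals s ''end'' a) +
        CU (reals s ''start'' t - reals s ''end'' x) -
        CU (reals s ''start'' t - reals s ''end'' a) = e"
      using ax0 xt at by (simp add: e_def)
    show ?thesis
      using inv False st' \<tau>1 \<tau>2 \<tau>3 e vx
      by (auto simp: pop_def runs_simps runs_Seq runs_If scan_inv_def is_input_def
          t_def[symmetric] x_def[symmetric] a_def[symmetric])
  qed
qed

lemma runs_push: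
  assumes inv: "scan_inv T L PDT CU v c xs s"
    and t: "nats s ''t'' 0 \<le> T"
    and top: "0 < nats s ''p'' 0 \<Longrightarrow>
      Poly_Mapping.lookup v (nats s ''t'' 0) \<le> Poly_Mapping.lookup v (nats s ''p'' 0)"
  shows "runs CU \<tau> push s (\<lambda>n s'. n \<le> 100 \<and> nats s' ''t'' 0 = Suc (nats s ''t'' 0) \<and>
      scan_inv T L PDT CU v c (nats s ''t'' 0 # xs) s')"
proof -
  define t x where "t = nats s ''t'' 0" and "x = nats s ''p'' 0"
  let ?E = "gap_cost T L PDT CU"
  have st: "scan_state ?E (Poly_Mapping.lookup v) T t x
         (nats s ''prev'') (reals s ''alpha'') (reals s ''sum'' 0) xs"
    using inv by (auto simp: scan_inv_def t_def x_def)
  have inp: "is_input s T L PDT v c" using inv by (simp add: scan_inv_def)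
  have t1: "1 \<le> t" "t \<le> T" using st assms(2) by (auto simp: scan_state_def t_def)
  have st': "scan_state ?E (Poly_Mapping.lookup v) T (Suc t) t ((nats s ''prev'')(t := x))
      (reals s ''alpha'') (reals s ''sum'' 0) (t # xs)"
    by (rule scan_state_push[OF st]) (use top t1 in \<open>auto simp: t_def x_def\<close>)
  have "reals s ''start'' t + reals s ''L'' t = period_end L PDT t"
    "period_start L PDT (Suc t) = period_end L PDT t"
    using inv t1
    by (auto simp: scan_inv_def is_input_def t_def[symmetric] period_start_def period_end_def
        atLeastLessThanSuc_atLeastAtMost sum.last_plus)
  then show ?thesis
    using inv st' t1
    by (auto simp: push_def runs_simps runs_Seq runs_If scan_inv_def is_input_def
        t_def[symmetric] x_def[symmetric] le_Suc_eq less_Suc_eq atLeastAtMostSuc_conv)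
qed

text \<open>Amortisation: a push lowers the first term of the potential by 2 and lengthens the stack
  by 1, while a pop shortens the stack by 1.\<close>

lemma runs_body:
  assumes inv: "scan_inv T L PDT CU v c xs s" and uc: "uc_data T L PDT CU"
    and \<tau>: "\<forall>x\<ge>0. \<tau> x \<le> \<kappa>" and test: "bval CU s scan_test"
  shows "runs CU \<tau> (If pop_test pop push) s (\<lambda>n s'. n \<le> 200 + 3 * \<kappa> \<and>
    (\<exists>ys. 2 * (Suc T - nats s' ''t'' 0) + length ys < 2 * (Suc T - nats s ''t'' 0) + length xs \<and>
      scan_inv T L PDT CU v c ys s'))"
proof -
  let ?t = "nats s ''t'' 0" and ?p = "nats s ''p'' 0"
  have st: "scan_state (gap_cost T L PDT CU) (Poly_Mapping.lookup v) T ?t ?p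
      (nats s ''prev'') (reals s ''alpha'') (reals s ''sum'' 0) xs"
    using inv by (simp add: scan_inv_def)
  have s: "nats s ''T'' 0 = T" "?p < ?t" "1 \<le> ?t" "?t \<le> Suc T"
    using inv by (auto simp: scan_inv_def is_input_def scan_state_def)
  have vt: "reals s ''v'' j = Poly_Mapping.lookup v j" if "1 \<le> j" "j \<le> T" for j
    using inv that by (auto simp: scan_inv_def is_input_def)
  show ?thesis
  proof (cases "bval CU s pop_test")
    case True
    then have p: "0 < ?p" by (simp add: pop_test_def)
    then have "xs \<noteq> []" using scan_state_stack[OF st] by auto
    then have "length (tl xs) < length xs" by (cases xs) auto
    moreover have "runs CU \<tau> pop s (\<lambda>n s'. n \<le> 100 + 3 * \<kappa> \<and> nats s' ''t'' 0 = ?t \<and>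
        scan_inv T L PDT CU v c (tl xs) s')"
      using s True by (intro runs_pop[OF inv uc \<tau> p]) (auto simp: pop_test_def vt)
    ultimately show ?thesis using True
      by (auto simp: runs_If pop_test_def elim!: runs_mono intro!: exI[of _ "tl xs"])
  next
    case False
    \<comment> \<open>With \<open>t > T\<close>, a failing \<open>pop_test\<close> would mean an
      empty stack, and then \<open>scan_test\<close> would fail as well.\<close>
    then have "?t \<le> T" using s test by (auto simp: pop_test_def scan_test_def)
    moreover have "runs CU \<tau> push s (\<lambda>n s'. n \<le> 100 \<and> nats s' ''t'' 0 = Suc ?t \<and>
        scan_inv T L PDT CU v c (?t # xs) s')"
      using s False \<open>?t \<le> T\<close> by (intro runs_push[OF inv]) (auto simp: pop_test_def vt)
    ultimately show ?thesis using False
      by (auto simp: runs_If pop_test_def elim!: runs_mono intro!: exI[of _ "?t # xs"])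
  qed
qed

text \<open>On exit the gap tree is a Cartesian tree of all of \<open>v\<close> and
  \<open>sum\<close> is its tree sum at \<open>v\<close>. Comparing this value with \<open>c\<close>
  therefore decides membership exactly.\<close>

lemma runs_answer:
  assumes inv: "scan_inv T L PDT CU v c xs s" and uc: "uc_data T L PDT CU"
    and v: "v \<in> cube01 T" and test: "\<not> bval CU s scan_test"
  shows "runs CU \<tau> answer s
    (\<lambda>n s'. n \<le> 50 \<and> correct_separation_output T L PDT CU v c s')"
proof -
  let ?E = "gap_cost T L PDT CU" and ?\<alpha> = "reals s ''alpha''" and ?z = "reals s ''sum'' 0"
  have inp: "nats s ''T'' 0 = T" "reals s ''c'' 0 = c"
    using inv by (auto simp: scan_inv_def is_input_def)
  have st: "scan_state ?E (Poly_Mapping.lookup v) T (nats s ''t'' 0) (nats s ''p'' 0)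
         (nats s ''prev'') ?\<alpha> ?z xs"
    using inv by (auto simp: scan_inv_def)
  have fin: "nats s ''t'' 0 = Suc T" "nats s ''p'' 0 = 0"
    \<comment> \<open>By truncated subtraction, the sum in \<open>scan_test\<close> is 0 just if the
      stack is empty and \<open>t > T\<close>.\<close>
    using test st inp by (auto simp: scan_test_def scan_state_def)
  have "set xs = {}" using st stack_subset unfolding scan_state_def fin by fastforce
  then obtain C where C: "cartesian (Poly_Mapping.lookup v) 0 C (Suc T)"
      "carries ?E ?\<alpha> 0 C (Suc T)"
    and z: "?z = (\<Sum>t=1..T. ?\<alpha> t * Poly_Mapping.lookup v t)"
    using st unfolding scan_state_def fin by (auto simp: atLeastLessThanSuc_atLeastAtMost)
  have sum: "tree_sum ?E 0 C (Suc T) w = (\<Sum>t=1..T. ?\<alpha> t * w t)" for w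
    using tree_sum_carries[OF C]
    by (simp add: atLeastSucLessThan_greaterThanLessThan[symmetric] atLeastLessThanSuc_atLeastAtMost)
  have rank: "rank_labeled T C" using cartesian_inorder[OF C(1)] by (simp add: rank_labeled_def)
  have "d \<ge> (\<Sum>t=1..T. ?\<alpha> t * Poly_Mapping.lookup w t)"
    if "(w, d) \<in> epigraph (cube01 T) (LCU T L PDT CU)" for w d
    using tree_sum_le_hull[OF uc, of C w d] that rank
    by (simp add: epigraph_LCU[OF uc] sum rank_labeled_def)
  moreover have "(v, c) \<in> epigraph (cube01 T) (LCU T L PDT CU) \<longleftrightarrow> ?z \<le> c"
    by (simp add: epigraph_LCU[OF uc] cartesian_hull_iff[OF uc v C(1)] sum z)
  ultimately show ?thesis using rank carries_tree_coeffs[OF C] inp z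
    by (auto simp: answer_def runs_simps runs_Seq runs_If correct_separation_output_def reports_membership_def
        returned_coeffs_def)
qed

theorem proposition7p1:
  "\<exists>prog :: com. \<forall>\<kappa> :: nat. \<exists>time :: nat \<Rightarrow> nat.
     (\<lambda>T. real (time T)) \<in> O(\<lambda>T. real T) \<and>
     (\<forall>(T :: nat) (L :: nat \<Rightarrow> real) (PDT :: real) (CU :: real \<Rightarrow> real) (\<tau> :: real \<Rightarrow> nat)
        (v :: nat \<Rightarrow>\<^sub>0 real) (c :: real) (s :: mem).
        uc_data T L PDT CU \<longrightarrow> (\<forall>x\<ge>0. \<tau> x \<le> \<kappa>) \<longrightarrow> v \<in> cube01 T \<longrightarrow> is_input s T L PDT v c \<longrightarrow>
        (\<exists>n s'. exec CU \<tau> prog s n s' \<and> n \<le> time T \<and>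
                correct_separation_output T L PDT CU v c s'))"
proof (rule exI[of _ separation], intro allI)
  fix \<kappa> :: nat
  \<comment> \<open>There are at most \<open>2 * T\<close> iterations, each with 20 steps for the
    test and \<open>200 + 3 * \<kappa>\<close> for the body. The 120 steps split into 50 for
    \<open>init\<close>, 50 for \<open>answer\<close> and 20 for the last test.\<close>
  define time where "time = (\<lambda>T. (20 + (200 + 3 * \<kappa>)) * (2 * T) + 120)"
  have "(\<lambda>T. real (time T)) \<in> O(\<lambda>T. real T)"
  proof (rule bigoI)
    show "\<forall>\<^sub>F T in sequentially. norm (real (time T)) \<le> real (time 1) * norm (real T)"
      using eventually_ge_at_top[of 1]
    proof eventually_elim
      case (elim T)
      then have "time T \<le> time 1 * T" by (simp add: time_def algebra_simps)
      then show ?case by (simp flip: of_nat_mult)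
    qed
  qed
  moreover have "runs CU \<tau> separation s
      (\<lambda>n s'. n \<le> time T \<and> correct_separation_output T L PDT CU v c s')"
    if uc: "uc_data T L PDT CU" and \<tau>: "\<forall>x\<ge>0. \<tau> x \<le> \<kappa>" and v: "v \<in> cube01 T"
      and inp: "is_input s T L PDT v c" for T L PDT CU \<tau> v c s
    unfolding separation_def runs_Seq
  proof (rule runs_mono[OF runs_init[OF inp uc]], elim conjE)
    fix n1 :: nat and s1
    assume n1: "n1 \<le> 50" and s1: "nats s1 ''t'' 0 = 1" "scan_inv T L PDT CU v c [] s1"
    define I where "I = (\<lambda>k s. \<exists>xs. k = 2 * (Suc T - nats s ''t'' 0) + length xs \<and>
      scan_inv T L PDT CU v c xs s)"
    show "runs CU \<tau> (While scan_test (If pop_test pop push)) s1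
       (\<lambda>m s'. runs CU \<tau> answer s'
         (\<lambda>n s'. n1 + (m + n) \<le> time T \<and> correct_separation_output T L PDT CU v c s'))"
    proof (rule runs_mono[OF runs_While[where I = I and c = 20 and k = "2 * T"]])
      show "bcost CU \<tau> s scan_test + 1 \<le> 20" for s by (simp add: scan_test_def)
      show "runs CU \<tau> (If pop_test pop push) s (\<lambda>n s'. n \<le> 200 + 3 * \<kappa> \<and> (\<exists>k'<k. I k' s'))"
        if "I k s" "bval CU s scan_test" for k s
      proof -
        obtain xs where "k = 2 * (Suc T - nats s ''t'' 0) + length xs"
          "scan_inv T L PDT CU v c xs s"
          using \<open>I k s\<close> unfolding I_def by blast
        then show ?thesis
          using runs_body[OF _ uc \<tau> that(2), of v c xs] unfolding I_def
          by (blast intro: runs_mono)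
      qed
      \<comment> \<open>At \<open>t = 1\<close> with an empty stack the potential is
        \<open>2 * T\<close>.\<close>
      show "I (2 * T) s1" using s1 by (auto simp: I_def)
    next
      fix m :: nat and s2
      assume a: "m \<le> (20 + (200 + 3 * \<kappa>)) * (2 * T) + 20 \<and>
        (\<exists>k'. I k' s2) \<and> \<not> bval CU s2 scan_test"
      then obtain xs where "scan_inv T L PDT CU v c xs s2" unfolding I_def by blast
      from runs_answer[OF this uc v] a
      have "runs CU \<tau> answer s2 (\<lambda>n s'. n \<le> 50 \<and> correct_separation_output T L PDT CU v c s')"
        by blast
      then show "runs CU \<tau> answer s2
          (\<lambda>n s'. n1 + (m + n) \<le> time T \<and> correct_separation_output T L PDT CU v c s')"
        by (rule runs_mono) (use a n1 in \<open>auto simp: time_def\<close>)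
    qed
  qed
  ultimately show "\<exists>time :: nat \<Rightarrow> nat.
     (\<lambda>T. real (time T)) \<in> O(\<lambda>T. real T) \<and>
     (\<forall>(T :: nat) (L :: nat \<Rightarrow> real) (PDT :: real) (CU :: real \<Rightarrow> real) (\<tau> :: real \<Rightarrow> nat)
        (v :: nat \<Rightarrow>\<^sub>0 real) (c :: real) (s :: mem).
        uc_data T L PDT CU \<longrightarrow> (\<forall>x\<ge>0. \<tau> x \<le> \<kappa>) \<longrightarrow> v \<in> cube01 T \<longrightarrow> is_input s T L PDT v c \<longrightarrow>
        (\<exists>n s'. exec CU \<tau> separation s n s' \<and> n \<le> time T \<and>
                correct_separation_output T L PDT CU v c s'))"
    unfolding runs_def by blast
qed

end
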